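(* Let $G$ be an infinite, connected, vertex-transitive, $d$-regular directed graph (with symmetric edge set). (i) Let $N$ be the number of infinite weak clusters. If $\theta(G,{\bf p})>0$, then $P_{\bf p}(N=1)=1$ or $P_{\bf p}(N=\infty)=1$. (ii) Let $\tilde N$ be the number of infinite strong clusters. If $\tilde\theta(G,{\bf p})>0$, then $P_{\bf p}(\tilde N=1)=1$ or $P_{\bf p}(\tilde N=\infty)=1$.
   Context: $G=(V,E,o)$ is an infinite simple directed graph with origin $o\in V$: $V$ is countably infinite, $E\subset V\times V\setminus\{(x,x)\}$, and $(x,y)\in E$ iff $(y,x)\in E$; $x\sim y$ means $(x,y)\in E$; $L_x=\{y:(x,y)\in E\}$. $G$ is $d$-regular ($|L_x|=d$ for all $x$), connected with respect to $\sim$, and vertex-transitive (automorphisms act transitively on $V$). Let ${\bf p}=(p_0,\dots,p_d)$ with $p_i\ge0$ and $\sum_i p_i=1$. Configurations are $\omega\in\Omega=\prod_{x\in V}2^{L_x}$ with the $\sigma$-field generated by finite-dimensional cylinders; $P_{\bf p}$ is the product measure under which the states $\omega(x)\subset L_x$ are independent with $P_{\bf p}(\omega(x)=S)=p_{|S|}/\binom{d}{|S|}$ for $S\subset L_x$. Put $E_\omega=\{(x,y):x\in V,\ y\in\omega(x)\}$. Vertices $x,y$ are weakly connected if $x=y$ or there are $x=z_0,\dots,z_m=y$ such that for each $i$, $(z_i,z_{i+1})\in E_\omega$ or $(z_{i+1},z_i)\in E_\omega$; strongly connected if $x=y$ or there is such a sequence with both $(z_i,z_{i+1})\in E_\omega$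 and $(z_{i+1},z_i)\in E_\omega$ for each $i$. Weak (strong) clusters are the equivalence classes of weak (strong) connection. $C$ and $\tilde C$ are the weak and strong clusters of $o$; $\theta(G,{\bf p})=P_{\bf p}(|C|=\infty)$ and $\tilde\theta(G,{\bf p})=P_{\bf p}(|\tilde C|=\infty)$. *)

theory Defs
  imports "HOL-Probability.Probability" "HOL-Library.Extended_Nat"
begin

definition graph_automorphism :: "'v set \<Rightarrow> ('v \<times> 'v) set \<Rightarrow> ('v \<Rightarrow> 'v) \<Rightarrow> bool" where
  "graph_automorphism V E f \<longleftrightarrow>
     bij_betw f V V \<and> (\<forall>x\<in>V. \<forall>y\<in>V. (f x, f y) \<in> E \<longleftrightarrow> (x, y) \<in> E)"

text \<open>
  The set of out-neighbours of \<open>x\<close> is \<open>E `` {x}\<close>. Its finiteness is required separately,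
  because \<open>card\<close> is \<open>0\<close> on infinite sets.
\<close>

locale transitive_digraph =
  fixes V :: "'v set" and E :: "('v \<times> 'v) set" and d :: nat
  assumes countable_V: "countable V"
    and infinite_V: "infinite V"
    and E_subset: "E \<subseteq> V \<times> V"
    and irrefl_E: "irrefl E"
    and sym_E: "sym E"
    and finite_nbrs: "x \<in> V \<Longrightarrow> finite (E `` {x})"
    and regular: "x \<in> V \<Longrightarrow> card (E `` {x}) = d"
    and connected: "x \<in> V \<Longrightarrow> y \<in> V \<Longrightarrow> (x, y) \<in> E\<^sup>*"
    and transitive: "x \<in> V \<Longrightarrow> y \<in> V \<Longrightarrow> \<exists>f. graph_automorphism V E f \<and> f x = y"

definition degree_distribution :: "nat \<Rightarrow> (nat \<Rightarrow> real) \<Rightarrow> bool" where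
  "degree_distribution d p \<longleftrightarrow> (\<forall>i\<le>d. 0 \<le> p i) \<and> (\<Sum>i\<le>d. p i) = 1"

text \<open>
  A configuration \<open>\<omega>\<close> is an element of the product over \<open>x \<in> V\<close> of the power sets of
  \<open>E `` {x}\<close>; the factors carry the discrete sigma-algebra.
\<close>

definition config_measure ::
    "'v set \<Rightarrow> ('v \<times> 'v) set \<Rightarrow> nat \<Rightarrow> (nat \<Rightarrow> real) \<Rightarrow> ('v \<Rightarrow> 'v set) measure" where
  "config_measure V E d p =
     (\<Pi>\<^sub>M x\<in>V. point_measure (Pow (E `` {x})) (\<lambda>S. ennreal (p (card S) / real (d choose card S))))"

definition open_edges :: "'v set \<Rightarrow> ('v \<Rightarrow> 'v set) \<Rightarrow> ('v \<times> 'v) set" where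
  "open_edges V \<omega> = {(x, y). x \<in> V \<and> y \<in> \<omega> x}"

definition weak_conn :: "'v set \<Rightarrow> ('v \<Rightarrow> 'v set) \<Rightarrow> ('v \<times> 'v) set" where
  "weak_conn V \<omega> = (open_edges V \<omega> \<union> (open_edges V \<omega>)\<inverse>)\<^sup>*"

definition strong_conn :: "'v set \<Rightarrow> ('v \<Rightarrow> 'v set) \<Rightarrow> ('v \<times> 'v) set" where
  "strong_conn V \<omega> = (open_edges V \<omega> \<inter> (open_edges V \<omega>)\<inverse>)\<^sup>*"

definition weak_theta ::
    "'v set \<Rightarrow> ('v \<times> 'v) set \<Rightarrow> nat \<Rightarrow> 'v \<Rightarrow> (nat \<Rightarrow> real) \<Rightarrow> real" where
  "weak_theta V E d r p = \<P>(\<omega> in config_measure V E d p. infinite (weak_conn V \<omega> `` {r}))"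

definition strong_theta ::
    "'v set \<Rightarrow> ('v \<times> 'v) set \<Rightarrow> nat \<Rightarrow> 'v \<Rightarrow> (nat \<Rightarrow> real) \<Rightarrow> real" where
  "strong_theta V E d r p = \<P>(\<omega> in config_measure V E d p. infinite (strong_conn V \<omega> `` {r}))"

definition ecard :: "'a set \<Rightarrow> enat" where
  "ecard A = (if finite A then enat (card A) else \<infinity>)"

text \<open>
  For \<open>x \<in> V\<close> the class of \<open>x\<close> lies inside \<open>V\<close>, so the quotients below are the sets of
  weak and strong clusters, although the relations also contain the diagonal outside \<open>V\<close>.
\<close>

definition num_inf_weak :: "'v set \<Rightarrow> ('v \<Rightarrow> 'v set) \<Rightarrow> enat" where
  "num_inf_weak V \<omega> = ecard {C \<in> V // weak_conn V \<omega>. infinite C}"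

definition num_inf_strong :: "'v set \<Rightarrow> ('v \<Rightarrow> 'v set) \<Rightarrow> enat" where
  "num_inf_strong V \<omega> = ecard {C \<in> V // strong_conn V \<omega>. infinite C}"

end

theory Submission
  imports Defs
begin

text \<open>
  The number of infinite clusters is invariant under automorphisms, and since automorphisms move
  finite sets of vertices arbitrarily far away, it is almost surely equal to some \<open>k\<close>. Almost
  surely it therefore stays equal to \<open>k\<close> when the state of finitely many vertices is replaced by
  states of positive probability. Suppose \<open>2 \<le> k < \<infinity>\<close>. There need not be finite energy: to let a
  vertex point to a given neighbour one may have to delete one of its other edges. If states of
  size at least two have positive probability, then the deleted edge can be chosen so that the
  cluster of the vertex stays infinite. In this way two infinite clusters can be brought next to
  each other, and then the count of clusters created by deletions and clusters merged by a new link
  is inconsistent with a constant number \<open>k\<close>.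

  If all states have size at most one, then strong clusters are trivially finite, while in the weak
  case forward orbits are finite because there are at most \<open>d (d - 1)\<^sup>n\<^sup>-\<^sup>1\<close> self-avoiding walks of
  length \<open>n\<close>, each of which is followed with probability at most \<open>d\<^sup>-\<^sup>n\<close>. So every
  cluster drains into a finite root, and moving the root of one infinite cluster step by step
  towards another one finally merges the two without loss.
\<close>

section \<open>Counting infinite clusters of a symmetric relation\<close>

text \<open>Probability serves only to produce a nonempty set \<open>T\<close> of configurations
  that is closed under single-vertex updates of positive probability and on which the count is
  exactly k. What follows is deterministic surgery inside \<open>T\<close>. Its bookkeeping rests on
  one fact: a new link lowers the number of infinite clusters by one if it joins two infinite ones,
  and otherwise leaves it alone. Hence, if the links that survive an update form at most k infinite
  clusters, the links it adds cannot have joined two of them, because the total must again be k.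

  The split by state size comes from deletions. Of two links at a vertex, one can always be cut so
  that the vertex keeps an infinite cluster, so a second out-neighbour is a spare one. With
  out-degree at most one there is no spare edge, and giving up the only one may cut a vertex off
  from the infinite part. A root is a vertex where this cannot happen: its whole cluster flows into
  it, so changing its own edge detaches nothing.\<close>

definition infinite_clusters :: "'v set \<Rightarrow> ('v \<times> 'v) set \<Rightarrow> 'v set set" where
  "infinite_clusters V R = {C \<in> V // R\<^sup>*. infinite C}"

abbreviation link :: "'v \<Rightarrow> 'v \<Rightarrow> ('v \<times> 'v) set" where
  "link x y \<equiv> {(x, y), (y, x)}"

lemma sym_link: "sym (link x y)"
  by (auto simp: sym_def)

lemma sym_add_link: "sym R \<Longrightarrow> sym (R \<union> link x y)"
  by (auto simp: sym_def)

lemma sym_remove_link: "sym R \<Longrightarrow> sym (R - link x y)"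
  by (auto simp: sym_def)

lemma rtrancl_sym_iff: "sym R \<Longrightarrow> (x, y) \<in> R\<^sup>* \<longleftrightarrow> (y, x) \<in> R\<^sup>*"
  by (meson sym_rtrancl symE)

lemma cluster_eq_iff: "sym R \<Longrightarrow> R\<^sup>* `` {x} = R\<^sup>* `` {y} \<longleftrightarrow> (x, y) \<in> R\<^sup>*"
  using rtrancl_sym_iff[of R] by (auto intro: rtrancl_trans)

lemma infinite_clusters_iff:
  "C \<in> infinite_clusters V R \<longleftrightarrow> (\<exists>x\<in>V. C = R\<^sup>* `` {x} \<and> infinite C)"
  by (auto simp: infinite_clusters_def quotient_def)

lemma cluster_in_infinite_clusters:
  "x \<in> V \<Longrightarrow> infinite (R\<^sup>* `` {x}) \<Longrightarrow> R\<^sup>* `` {x} \<in> infinite_clusters V R"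
  by (auto simp: infinite_clusters_iff)

lemma rtrancl_add_link:
  assumes "sym R"
  shows "(R \<union> link x y)\<^sup>* = R\<^sup>* \<union> R\<^sup>* `` {x} \<times> R\<^sup>* `` {y} \<union> R\<^sup>* `` {y} \<times> R\<^sup>* `` {x}"
proof -
  have s: "(u, v) \<in> R\<^sup>* \<longleftrightarrow> (v, u) \<in> R\<^sup>*" for u v
    by (rule rtrancl_sym_iff[OF assms])
  have "(R \<union> link x y)\<^sup>* = (insert (x, y) (insert (y, x) R))\<^sup>*"
    by (rule arg_cong[where f = rtrancl]) auto
  also have "\<dots> = R\<^sup>* \<union> R\<^sup>* `` {x} \<times> R\<^sup>* `` {y} \<union> R\<^sup>* `` {y} \<times> R\<^sup>* `` {x}"
    unfolding rtrancl_insert using s by (auto intro: rtrancl_trans)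
  finally show ?thesis .
qed

lemma cluster_add_link:
  fixes x y :: 'v
  assumes "sym R"
  defines "U \<equiv> R\<^sup>* `` {x} \<union> R\<^sup>* `` {y}"
  shows "(R \<union> link x y)\<^sup>* `` {z} = (if z \<in> U then U else R\<^sup>* `` {z})"
proof -
  have s: "(u, v) \<in> R\<^sup>* \<longleftrightarrow> (v, u) \<in> R\<^sup>*" for u v
    by (rule rtrancl_sym_iff[OF assms(1)])
  show ?thesis
    unfolding rtrancl_add_link[OF assms(1)] U_def using s by (auto intro: rtrancl_trans)
qed

lemma infinite_clusters_add_link:
  fixes x y :: 'v
  assumes R: "sym R" and V: "x \<in> V" "y \<in> V" and n: "(x, y) \<notin> R\<^sup>*"
  defines "X \<equiv> R\<^sup>* `` {x}" and "Y \<equiv> R\<^sup>* `` {y}"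
  shows "infinite_clusters V (R \<union> link x y) =
           infinite_clusters V R - {X, Y} \<union> (if infinite X \<or> infinite Y then {X \<union> Y} else {})"
proof (rule set_eqI)
  fix C
  note cl = cluster_add_link[OF R, of x y, folded X_def Y_def]
  have XY: "R\<^sup>* `` {z} \<in> {X, Y} \<longleftrightarrow> z \<in> X \<union> Y" for z
    using cluster_eq_iff[OF R] rtrancl_sym_iff[OF R] by (auto simp: X_def Y_def)
  have xX: "x \<in> X \<union> Y" by (simp add: X_def)
  show "C \<in> infinite_clusters V (R \<union> link x y) \<longleftrightarrow>
    C \<in> infinite_clusters V R - {X, Y} \<union> (if infinite X \<or> infinite Y then {X \<union> Y} else {})"
  proof
    assume "C \<in> infinite_clusters V (R \<union> link x y)"
    then obtain z where "z \<in> V" "C = (R \<union> link x y)\<^sup>* `` {z}" "infinite C"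
      by (auto simp: infinite_clusters_iff)
    then show "C \<in> infinite_clusters V R - {X, Y} \<union> (if infinite X \<or> infinite Y then {X \<union> Y} else {})"
      using cl[of z] XY[of z] by (auto simp: infinite_clusters_iff split: if_splits)
  next
    assume "C \<in> infinite_clusters V R - {X, Y} \<union> (if infinite X \<or> infinite Y then {X \<union> Y} else {})"
    then consider "C \<in> infinite_clusters V R" "C \<notin> {X, Y}" | "C = X \<union> Y" "infinite C"
      by (auto split: if_splits)
    then show "C \<in> infinite_clusters V (R \<union> link x y)"
    proof cases
      case 1
      then obtain z where z: "z \<in> V" "C = R\<^sup>* `` {z}" "infinite C"
        by (auto simp: infinite_clusters_iff)
      with 1 XY[of z] have "z \<notin> X \<union> Y" by auto
      with cl[of z] z show ?thesis by (auto simp: infinite_clusters_iff)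
    next
      case 2
      with cl[of x] xX V show ?thesis by (auto simp: infinite_clusters_iff)
    qed
  qed
qed

text \<open>The classes X and Y of the endpoints give way to their union, which is infinite as soon
  as one of them is, so a cluster is lost from the count only if both were infinite and distinct.
  Deletions are handled by reading this backwards.\<close>

lemma card_infinite_clusters_add_link:
  assumes R: "sym R" and V: "x \<in> V" "y \<in> V"
  shows "finite (infinite_clusters V (R \<union> link x y)) \<longleftrightarrow> finite (infinite_clusters V R)" (is ?fin)
    and "finite (infinite_clusters V R) \<Longrightarrow>
      card (infinite_clusters V R) = card (infinite_clusters V (R \<union> link x y)) +
        of_bool ((x, y) \<notin> R\<^sup>* \<and> infinite (R\<^sup>* `` {x}) \<and> infinite (R\<^sup>* `` {y}))" (is "_ \<Longrightarrow> ?card")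
proof -
  have *: "?fin \<and> (finite (infinite_clusters V R) \<longrightarrow> ?card)"
  proof (cases "(x, y) \<in> R\<^sup>*")
    case True
    then have "(R \<union> link x y)\<^sup>* = R\<^sup>*"
      using rtrancl_sym_iff[OF R] unfolding rtrancl_add_link[OF R] by (auto intro: rtrancl_trans)
    then show ?thesis using True by (auto simp: infinite_clusters_def)
  next
    case False
    define X Y where "X = R\<^sup>* `` {x}" and "Y = R\<^sup>* `` {y}"
    define K where "K = infinite_clusters V R"
    have ne: "X \<noteq> Y" using False cluster_eq_iff[OF R, of x y] by (simp add: X_def Y_def)
    have X: "X \<in> K \<longleftrightarrow> infinite X" and Y: "Y \<in> K \<longleftrightarrow> infinite Y"
      using V by (auto simp: K_def infinite_clusters_iff X_def Y_def)
    have "X \<union> Y \<notin> K - {X, Y}"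
    proof
      assume "X \<union> Y \<in> K - {X, Y}"
      then obtain z where "X \<union> Y = R\<^sup>* `` {z}" by (auto simp: K_def infinite_clusters_iff)
      moreover have "x \<in> X \<union> Y" "y \<in> X \<union> Y" by (auto simp: X_def Y_def)
      ultimately have "(z, x) \<in> R\<^sup>*" "(z, y) \<in> R\<^sup>*" by auto
      then show False using False rtrancl_sym_iff[OF R] by (meson rtrancl_trans)
    qed
    moreover have "infinite_clusters V (R \<union> link x y) =
        K - {X, Y} \<union> (if infinite X \<or> infinite Y then {X \<union> Y} else {})"
      using infinite_clusters_add_link[OF R V False] by (simp add: X_def Y_def K_def)
    moreover have "card K = card (K - {X, Y}) + card (K \<inter> {X, Y})" if "finite K"
      using that card_Diff_subset_Int[of K "{X, Y}"] card_mono[of K "K \<inter> {X, Y}"] by auto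
    moreover have "K \<inter> {X, Y} = (if infinite X then {X} else {}) \<union> (if infinite Y then {Y} else {})"
      using X Y by auto
    ultimately show ?thesis
      using ne False by (auto simp: X_def[symmetric] Y_def[symmetric] K_def[symmetric])
  qed
  show ?fin using * by blast
  show ?card if "finite (infinite_clusters V R)" using * that by blast
qed

text \<open>Induction over the finitely many new pairs, each added together with its converse so
  that symmetry holds at every stage.\<close>

lemma card_infinite_clusters_mono:
  assumes "sym R" "sym R'" "R \<subseteq> R'" "finite (R' - R)" "R' - R \<subseteq> V \<times> V"
  shows "finite (infinite_clusters V R') \<longleftrightarrow> finite (infinite_clusters V R)"
    and "finite (infinite_clusters V R) \<Longrightarrow>
           card (infinite_clusters V R') \<le> card (infinite_clusters V R)"
proof -
  have *: "(finite (infinite_clusters V (R \<union> D \<union> D\<inverse>)) \<longleftrightarrow> finite (infinite_clusters V R)) \<and>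
    (finite (infinite_clusters V R) \<longrightarrow>
       card (infinite_clusters V (R \<union> D \<union> D\<inverse>)) \<le> card (infinite_clusters V R))"
    if "finite D" "D \<subseteq> V \<times> V" for D
    using that
  proof (induction D rule: finite_induct)
    case (insert e D)
    obtain x y where e: "e = (x, y)" by force
    let ?R = "R \<union> D \<union> D\<inverse>"
    have s: "sym ?R" using assms(1) by (auto simp: sym_def)
    have "R \<union> insert e D \<union> (insert e D)\<inverse> = ?R \<union> link x y" by (auto simp: e)
    with card_infinite_clusters_add_link[OF s, of x V y] insert show ?case by (auto simp: e)
  qed simp
  have "R \<union> (R' - R) \<union> (R' - R)\<inverse> = R'" using assms(1-3) by (auto simp: sym_def)
  with *[OF assms(4,5)]
  show "finite (infinite_clusters V R') \<longleftrightarrow> finite (infinite_clusters V R)"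
    and "finite (infinite_clusters V R) \<Longrightarrow>
           card (infinite_clusters V R') \<le> card (infinite_clusters V R)" by simp_all
qed

text \<open>If x and y were connected in \<open>R'\<close>, linking them would change nothing there,
  but in \<open>R\<close> it costs an infinite cluster. Monotonicity from
  \<open>R \<union> link x y\<close> to \<open>R' \<union> link x y\<close> then contradicts
  \<open>le\<close>.\<close>

lemma not_connected_mono:
  assumes R: "sym R" "sym R'" "R \<subseteq> R'" "finite (R' - R)" "R' - R \<subseteq> V \<times> V"
    and fin: "finite (infinite_clusters V R)"
    and le: "card (infinite_clusters V R) \<le> card (infinite_clusters V R')"
    and xy: "x \<in> V" "y \<in> V" "infinite (R\<^sup>* `` {x})" "infinite (R\<^sup>* `` {y})" "(x, y) \<notin> R\<^sup>*"
  shows "(x, y) \<notin> R'\<^sup>*"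
proof
  assume c: "(x, y) \<in> R'\<^sup>*"
  have fin': "finite (infinite_clusters V R')"
    using card_infinite_clusters_mono(1)[OF R] fin by blast
  note add = card_infinite_clusters_add_link[OF R(1) xy(1,2)]
  have "card (infinite_clusters V R') = card (infinite_clusters V (R' \<union> link x y))"
    using card_infinite_clusters_add_link(2)[OF R(2) xy(1,2) fin'] c by simp
  also have "\<dots> \<le> card (infinite_clusters V (R \<union> link x y))"
  proof (rule card_infinite_clusters_mono(2))
    show "sym (R \<union> link x y)" "sym (R' \<union> link x y)"
      using R(1,2) by (simp_all only: sym_add_link)
    have "R' \<union> link x y - (R \<union> link x y) \<subseteq> R' - R" by blast
    then show "finite (R' \<union> link x y - (R \<union> link x y))" "R' \<union> link x y - (R \<union> link x y) \<subseteq> V \<times> V"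
      using R(4,5) by (auto intro: finite_subset)
    show "finite (infinite_clusters V (R \<union> link x y))" using add(1) fin by blast
  qed (use R(3) in auto)
  also have "\<dots> < card (infinite_clusters V R)" using add(2)[OF fin] xy by simp
  finally show False using le by simp
qed

text \<open>A path from x can leave common ground only along a pair that starts in the cluster. This
  is the locality principle behind the later claims that an update elsewhere leaves a cluster
  unchanged.\<close>

lemma cluster_cong:
  assumes "\<And>u v. u \<in> R\<^sup>* `` {x} \<Longrightarrow> (u, v) \<in> R \<longleftrightarrow> (u, v) \<in> R'"
  shows "R'\<^sup>* `` {x} = R\<^sup>* `` {x}"
proof (intro equalityI subsetI)
  fix z assume "z \<in> R'\<^sup>* `` {x}"
  then have "(x, z) \<in> R'\<^sup>*" by simp
  then show "z \<in> R\<^sup>* `` {x}"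
  proof (induction rule: rtrancl_induct)
    case (step u v)
    then have "(u, v) \<in> R" using assms by blast
    with step show ?case by (auto intro: rtrancl_into_rtrancl)
  qed simp
next
  fix z assume "z \<in> R\<^sup>* `` {x}"
  then have "(x, z) \<in> R\<^sup>*" by simp
  then have "(x, z) \<in> R'\<^sup>* \<and> (x, z) \<in> R\<^sup>*"
  proof (induction rule: rtrancl_induct)
    case (step u v)
    then have "(u, v) \<in> R'" using assms by blast
    with step show ?case by (auto intro: rtrancl_into_rtrancl)
  qed simp
  then show "z \<in> R'\<^sup>* `` {x}" by simp
qed

text \<open>
  Whether the deletion of a link splits an infinite cluster in two infinite parts only depends
  on the cluster that contains the link.
\<close>

lemma card_infinite_clusters_remove_links:
  assumes R: "sym R" and V: "x \<in> V" "w \<in> V" "y \<in> V" "v \<in> V"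
    and xy: "(x, y) \<notin> R\<^sup>*"
    and fin: "finite (infinite_clusters V R)"
  shows "card (infinite_clusters V (R - link x w - link y v)) + card (infinite_clusters V R) =
         card (infinite_clusters V (R - link x w)) + card (infinite_clusters V (R - link y v))"
proof (cases "(x, w) \<in> R \<and> (y, v) \<in> R")
  case False
  then have "R - link x w = R \<or> R - link y v = R" using R by (auto simp: sym_def)
  moreover have "R - link x w - link y v = R - link y v - link x w" by blast
  ultimately show ?thesis by (metis add.commute)
next
  case links: True
  then have True: "(x, w) \<in> R" and v: "(y, v) \<in> R" by simp_all
  define A B where "A = R - link x w" and "B = R - link x w - link y v"
  have sA: "sym A" and sB: "sym B" and sC: "sym (R - link y v)"
    using R by (auto simp: A_def B_def sym_def)
  have RA: "A \<union> link x w = R" using True R by (auto simp: A_def sym_def)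
  have xw: "(x, w) \<in> R\<^sup>*" using True by blast
  have BC: "B \<union> link x w = R - link y v"
  proof -
    have "(x, w) \<noteq> (y, v)" "(x, w) \<noteq> (v, y)" using xy xw by auto
    then show ?thesis using True R by (auto simp: B_def sym_def)
  qed
  have AR: "A\<^sup>* \<subseteq> R\<^sup>*" by (rule rtrancl_mono) (auto simp: A_def)
  \<comment> \<open>Both endpoints of \<open>link y v\<close> lie outside the cluster of x in
    \<open>R\<close>, so cutting \<open>link x w\<close> has the same effect before and after
    cutting \<open>link y v\<close>.\<close>
  have loc: "B\<^sup>* `` {z} = A\<^sup>* `` {z}" if z: "(x, z) \<in> R\<^sup>*" for z
  proof (rule cluster_cong)
    fix a b assume "a \<in> A\<^sup>* `` {z}"
    then have "(x, a) \<in> R\<^sup>*" using AR z by (auto intro: rtrancl_trans)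
    moreover have "(x, v) \<notin> R\<^sup>*"
      using xy symD[OF R v] by (auto intro: rtrancl_into_rtrancl)
    ultimately have "a \<noteq> y" "a \<noteq> v" using xy by auto
    then show "(a, b) \<in> A \<longleftrightarrow> (a, b) \<in> B" by (auto simp: A_def B_def)
  qed
  have cw: "B\<^sup>* `` {w} = A\<^sup>* `` {w}" and cx: "B\<^sup>* `` {x} = A\<^sup>* `` {x}" using loc xw by auto
  have cxw: "(x, w) \<in> B\<^sup>* \<longleftrightarrow> (x, w) \<in> A\<^sup>*" using cx by auto
  have finA: "finite (infinite_clusters V A)"
    using card_infinite_clusters_add_link(1)[OF sA V(1,2)] RA fin by simp
  have "finite (infinite_clusters V (R - link y v))"
  proof -
    have "R - link y v \<union> link y v = R" using v R by (auto simp: sym_def)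
    then show ?thesis using card_infinite_clusters_add_link(1)[OF sC V(3,4)] fin by simp
  qed
  then have finB: "finite (infinite_clusters V B)"
    using card_infinite_clusters_add_link(1)[OF sB V(1,2)] BC by simp
  have "card (infinite_clusters V B) + card (infinite_clusters V R) =
      card (infinite_clusters V A) + card (infinite_clusters V (R - link y v))"
    using card_infinite_clusters_add_link(2)[OF sA V(1,2) finA]
      card_infinite_clusters_add_link(2)[OF sB V(1,2) finB]
    unfolding RA BC cxw cx cw by simp
  then show ?thesis by (simp only: A_def B_def)
qed

text \<open>After its last visit to x, a path uses at most one of the two links. So the two reduced
  clusters cover the original one, and one of them is infinite.\<close>

lemma infinite_cluster_remove_one_of_two:
  assumes "sym R" "w \<noteq> w'" "infinite (R\<^sup>* `` {x})"
  shows "infinite ((R - link x w)\<^sup>* `` {x}) \<or> infinite ((R - link x w')\<^sup>* `` {x})"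
proof -
  have "R\<^sup>* `` {x} \<subseteq> (R - link x w)\<^sup>* `` {x} \<union> (R - link x w')\<^sup>* `` {x}" (is "_ \<subseteq> ?A \<union> ?B")
  proof
    fix z assume "z \<in> R\<^sup>* `` {x}"
    then have "(x, z) \<in> R\<^sup>*" by simp
    then show "z \<in> ?A \<union> ?B"
    proof (induction rule: rtrancl_induct)
      case (step u v)
      have 1: "(u, v) \<in> R - link x s \<Longrightarrow> u \<in> (R - link x s)\<^sup>* `` {x} \<Longrightarrow> v \<in> (R - link x s)\<^sup>* `` {x}" for s
        by (auto intro: rtrancl_into_rtrancl)
      have 2: "(x, s) \<in> R \<Longrightarrow> s \<noteq> s' \<Longrightarrow> s \<in> (R - link x s')\<^sup>* `` {x}" for s s'
        by (cases "s = x") (auto intro!: r_into_rtrancl)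
      from step 1[of w] 1[of w'] 2[of w w'] 2[of w' w] \<open>w \<noteq> w'\<close> show ?case
        by (cases "v = x") auto
    qed simp
  qed
  then show ?thesis using assms(3) by (meson finite_UnI finite_subset)
qed

lemma cluster_remove_other_link:
  assumes "sym R" "(x, y) \<notin> R\<^sup>*"
  shows "(R - link x w)\<^sup>* `` {y} = R\<^sup>* `` {y}"
proof (rule cluster_cong)
  fix u v assume "u \<in> R\<^sup>* `` {y}"
  then have "(y, u) \<in> R\<^sup>*" by simp
  moreover have "(y, x) \<notin> R\<^sup>*" using assms rtrancl_sym_iff[of R] by auto
  ultimately have "u \<noteq> x" "(u, v) \<in> R \<Longrightarrow> v \<noteq> x" by (auto intro: rtrancl_into_rtrancl)
  then show "(u, v) \<in> R \<longleftrightarrow> (u, v) \<in> R - link x w" by auto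
qed

lemma cluster_isolate_other:
  assumes "sym R" "(z, x) \<notin> R\<^sup>*"
  shows "(R - {e. fst e = z \<or> snd e = z})\<^sup>* `` {x} = R\<^sup>* `` {x}"
proof (rule cluster_cong)
  fix u v assume "u \<in> R\<^sup>* `` {x}"
  then have "(x, u) \<in> R\<^sup>*" by simp
  moreover have "(x, z) \<notin> R\<^sup>*" using assms rtrancl_sym_iff[of R] by auto
  ultimately have "u \<noteq> z" "(u, v) \<in> R \<Longrightarrow> v \<noteq> z" by (auto intro: rtrancl_into_rtrancl)
  then show "(u, v) \<in> R \<longleftrightarrow> (u, v) \<in> R - {e. fst e = z \<or> snd e = z}" by auto
qed

text \<open>Isolating z breaks up only its own cluster, which is finite and leaves only finite
  pieces.\<close>

lemma infinite_clusters_isolate: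
  assumes "sym R" "finite (R\<^sup>* `` {z})"
  shows "infinite_clusters V (R - {e. fst e = z \<or> snd e = z}) = infinite_clusters V R"
proof -
  let ?Q = "R - {e. fst e = z \<or> snd e = z}"
  have QR: "?Q\<^sup>* \<subseteq> R\<^sup>*" by (rule rtrancl_mono) auto
  have "infinite (?Q\<^sup>* `` {c}) \<and> C = ?Q\<^sup>* `` {c} \<longleftrightarrow> infinite (R\<^sup>* `` {c}) \<and> C = R\<^sup>* `` {c}" for c C
  proof (cases "(z, c) \<in> R\<^sup>*")
    case True
    then have "finite (R\<^sup>* `` {c})" using assms cluster_eq_iff[of R z c] by simp
    moreover from this have "finite (?Q\<^sup>* `` {c})" using QR by (blast intro: finite_subset)
    ultimately show ?thesis by simp
  next
    case False
    then show ?thesis using cluster_isolate_other[OF assms(1)] by auto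
  qed
  then show ?thesis unfolding infinite_clusters_def quotient_def by blast
qed

text \<open>Strong links for \<open>s = True\<close>, weak links for \<open>s = False\<close>.\<close>

definition links :: "bool \<Rightarrow> 'v set \<Rightarrow> ('v \<Rightarrow> 'v set) \<Rightarrow> ('v \<times> 'v) set" where
  "links s V \<eta> = {(x, y). x \<in> V \<and> y \<in> V \<and>
     (if s then y \<in> \<eta> x \<and> x \<in> \<eta> y else y \<in> \<eta> x \<or> x \<in> \<eta> y)}"

lemma sym_links: "sym (links s V \<eta>)"
  by (auto simp: links_def sym_def)

lemma links_upd_iff: "u \<noteq> x \<Longrightarrow> v \<noteq> x \<Longrightarrow> (u, v) \<in> links s V (\<eta>(x := S)) \<longleftrightarrow> (u, v) \<in> links s V \<eta>"
  by (auto simp: links_def)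

text \<open>\<open>X\<close> holds the links that may be lost; its symmetry lets the hypothesis on
  single arrows cover both arrows of a link.\<close>

lemma links_mono_except:
  assumes "sym X" "\<And>a b. b \<in> \<eta> a \<Longrightarrow> (a, b) \<notin> X \<Longrightarrow> b \<in> \<eta>' a"
  shows "links s V \<eta> - X \<subseteq> links s V \<eta>'"
proof (rule subrelI)
  fix a b assume ab: "(a, b) \<in> links s V \<eta> - X"
  then have "(a, b) \<notin> X" "(b, a) \<notin> X" using assms(1) by (auto dest: symD)
  with ab assms(2)[of b a] assms(2)[of a b] show "(a, b) \<in> links s V \<eta>'"
    by (cases s) (auto simp: links_def)
qed

lemma (in transitive_digraph) finite_incident:
  assumes "x \<in> V" shows "finite {e \<in> E. fst e = x \<or> snd e = x}"
proof (rule finite_subset)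
  show "{e \<in> E. fst e = x \<or> snd e = x} \<subseteq> {x} \<times> E `` {x} \<union> E `` {x} \<times> {x}"
    using sym_E by (auto dest: symD)
  show "finite ({x} \<times> E `` {x} \<union> E `` {x} \<times> {x})"
    using finite_nbrs[OF assms] by auto
qed

section \<open>Sets of configurations closed under local modifications\<close>

text \<open>Membership in \<open>T\<close> replaces "almost surely"; \<open>upd\<close> is the only
  source of new configurations, and \<open>card_k\<close> is the conserved quantity that every
  contradiction below violates.\<close>

locale closed_configs = transitive_digraph V E d
  for V :: "'v set" and E d +
  fixes p :: "nat \<Rightarrow> real" and s :: bool and k :: nat and T :: "('v \<Rightarrow> 'v set) set"
  assumes state: "\<eta> \<in> T \<Longrightarrow> x \<in> V \<Longrightarrow> \<eta> x \<subseteq> E `` {x}"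
    and state_pos: "\<eta> \<in> T \<Longrightarrow> x \<in> V \<Longrightarrow> 0 < p (card (\<eta> x))"
    and upd: "\<eta> \<in> T \<Longrightarrow> x \<in> V \<Longrightarrow> S \<subseteq> E `` {x} \<Longrightarrow> 0 < p (card S) \<Longrightarrow> \<eta>(x := S) \<in> T"
    and fin: "\<eta> \<in> T \<Longrightarrow> finite (infinite_clusters V (links s V \<eta>))"
    and card_k: "\<eta> \<in> T \<Longrightarrow> card (infinite_clusters V (links s V \<eta>)) = k"
begin

abbreviation "L \<equiv> links s V"

lemma links_subset: "\<eta> \<in> T \<Longrightarrow> L \<eta> \<subseteq> E"
proof
  fix e assume T: "\<eta> \<in> T" and "e \<in> L \<eta>"
  then obtain x y where e: "e = (x, y)" "x \<in> V" "y \<in> V" "y \<in> \<eta> x \<or> x \<in> \<eta> y"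
    by (auto simp: links_def split: if_splits)
  then have "(x, y) \<in> E \<or> (y, x) \<in> E" using state[OF T] by blast
  then show "e \<in> E" using sym_E e by (meson symD)
qed

definition separated :: "('v \<Rightarrow> 'v set) \<Rightarrow> 'v \<Rightarrow> 'v \<Rightarrow> bool" where
  "separated \<eta> x y \<longleftrightarrow> \<eta> \<in> T \<and> x \<in> V \<and> y \<in> V \<and> (x, y) \<notin> (L \<eta>)\<^sup>* \<and>
     infinite ((L \<eta>)\<^sup>* `` {x}) \<and> infinite ((L \<eta>)\<^sup>* `` {y})"

lemma separated_commute: "separated \<eta> x y \<Longrightarrow> separated \<eta> y x"
  using rtrancl_sym_iff[OF sym_links, of x y s V \<eta>] by (simp add: separated_def)

lemma separated_irrefl: "\<not> separated \<eta> x x"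
  by (simp add: separated_def)

lemma separated_not_link: "separated \<eta> x y \<Longrightarrow> (x, y) \<notin> L \<eta>"
  by (auto simp: separated_def)

lemma separated_cases:
  assumes "separated \<eta> x y" "z \<in> V" "infinite ((L \<eta>)\<^sup>* `` {z})"
  shows "separated \<eta> x z \<or> separated \<eta> z y"
  using assms rtrancl_trans[of x z "L \<eta>" y] unfolding separated_def by blast

lemma finite_diff_upd2:
  assumes T: "\<eta>' \<in> T" and xy: "x \<in> V" "y \<in> V"
    and eq: "\<And>u v. u \<notin> {x, y} \<Longrightarrow> v \<notin> {x, y} \<Longrightarrow> (u, v) \<in> L \<eta>' \<Longrightarrow> (u, v) \<in> R"
  shows "finite (L \<eta>' - R)" and "L \<eta>' - R \<subseteq> V \<times> V"
proof -
  have "L \<eta>' - R \<subseteq> {e \<in> E. fst e = x \<or> snd e = x} \<union> {e \<in> E. fst e = y \<or> snd e = y}"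
    using links_subset[OF T] eq by (auto; blast)
  then show "finite (L \<eta>' - R)"
    using finite_incident xy by (meson finite_UnI finite_subset)
  show "L \<eta>' - R \<subseteq> V \<times> V" using links_subset[OF T] E_subset by auto
qed

text \<open>\<open>R\<close> is what certainly survives of the old links. Going from
  \<open>R\<close> to \<open>L \<eta>'\<close> can only lower the count, and it ends at k; as it
  starts at no more than k, no two infinite clusters were joined.\<close>

lemma separated_mono:
  assumes T: "\<eta>' \<in> T" and R: "sym R" "R \<subseteq> L \<eta>'" "finite (L \<eta>' - R)"
    and card: "finite (infinite_clusters V R)" "card (infinite_clusters V R) \<le> k"
    and xy: "x \<in> V" "y \<in> V" "infinite (R\<^sup>* `` {x})" "infinite (R\<^sup>* `` {y})" "(x, y) \<notin> R\<^sup>*"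
  shows "separated \<eta>' x y"
proof -
  have "L \<eta>' - R \<subseteq> V \<times> V" using links_subset[OF T] E_subset by auto
  then have "(x, y) \<notin> (L \<eta>')\<^sup>*"
    using not_connected_mono[OF R(1) sym_links R(2,3) _ card(1) _ xy] card_k[OF T] card(2) by simp
  moreover have "infinite ((L \<eta>')\<^sup>* `` {z})" if "infinite (R\<^sup>* `` {z})" for z
  proof -
    have "R\<^sup>* `` {z} \<subseteq> (L \<eta>')\<^sup>* `` {z}" using rtrancl_mono[OF R(2)] by auto
    with that show ?thesis by (rule infinite_super[rotated])
  qed
  ultimately show ?thesis using T xy by (auto simp: separated_def)
qed

lemma separated_upd_mono:
  assumes "separated \<eta> x y" "\<eta>(z := S) \<in> T" "z \<in> V" "L \<eta> \<subseteq> L (\<eta>(z := S))"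
  shows "separated (\<eta>(z := S)) x y"
proof (rule separated_mono[of _ "L \<eta>"])
  show "finite (L (\<eta>(z := S)) - L \<eta>)"
    by (rule finite_diff_upd2(1)[of _ z z]) (use assms in \<open>auto simp: links_upd_iff\<close>)
qed (use assms fin card_k sym_links in \<open>auto simp: separated_def\<close>)

lemma card_remove_link:
  assumes "\<eta> \<in> T" "x \<in> V" "w \<in> V"
  shows "finite (infinite_clusters V (L \<eta> - link x w))"
proof (cases "(x, w) \<in> L \<eta>")
  case True
  then have "L \<eta> - link x w \<union> link x w = L \<eta>" using sym_links[of s V \<eta>] by (auto simp: sym_def)
  then show ?thesis
    using card_infinite_clusters_add_link(1)[OF sym_remove_link[OF sym_links] assms(2,3), of s V \<eta> x w]
      fin[OF assms(1)] by simp
next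
  case False
  then have "L \<eta> - link x w = L \<eta>" using sym_links[of s V \<eta>] by (auto simp: sym_def)
  with fin[OF assms(1)] show ?thesis by simp
qed

end

section \<open>Surgery when some state of size at least two has positive probability\<close>

locale closed_configs_two = closed_configs V E d p s k T
  for V :: "'v set" and E d p s k T +
  fixes i :: nat
  assumes i: "2 \<le> i" "i \<le> d" "0 < p i"
begin

text \<open>Two prescribed neighbours are enough: a new target and at most one old out-neighbour
  that has to be kept.\<close>

lemma extend_state:
  assumes "x \<in> V" "A \<subseteq> E `` {x}" "card A \<le> 2"
  obtains S where "A \<subseteq> S" "S \<subseteq> E `` {x}" "0 < p (card S)"
proof -
  have "card A \<le> i" "i \<le> card (E `` {x})" using assms regular i by auto
  then obtain S where "A \<subseteq> S" "S \<subseteq> E `` {x}" "card S = i"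
    using exists_subset_between[OF _ _ assms(2) finite_nbrs[OF assms(1)]] by blast
  with i that show thesis by blast
qed

text \<open>
  \<open>S\<close> is a new state of \<open>x\<close> that contains \<open>y\<close> and costs \<open>x\<close> at most the link to \<open>w\<close>; no link is
  lost if \<open>w = x\<close>.
\<close>

definition redirect :: "('v \<Rightarrow> 'v set) \<Rightarrow> 'v \<Rightarrow> 'v \<Rightarrow> 'v set \<Rightarrow> 'v \<Rightarrow> bool" where
  "redirect \<eta> x y S w \<longleftrightarrow> S \<subseteq> E `` {x} \<and> 0 < p (card S) \<and> y \<in> S \<and> w \<in> V \<and>
     infinite ((L \<eta> - link x w)\<^sup>* `` {x}) \<and>
     (w = x \<and> \<eta> x \<subseteq> S \<or> w \<in> \<eta> x \<and> w \<noteq> x \<and> w \<noteq> y \<and> S = insert y (\<eta> x - {w}))"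

lemma not_self: "(x, x) \<notin> E"
  using irrefl_E by (simp add: irrefl_def)

lemma redirect_exists:
  assumes T: "\<eta> \<in> T" and xy: "(x, y) \<in> E" "y \<notin> \<eta> x" and inf: "infinite ((L \<eta>)\<^sup>* `` {x})"
  shows "\<exists>S w. redirect \<eta> x y S w"
proof -
  have x: "x \<in> V" using xy E_subset by auto
  note st = state[OF T x]
  have fi: "finite (\<eta> x)" using st finite_nbrs[OF x] finite_subset by blast
  show ?thesis
  proof (cases "card (\<eta> x) \<le> 1")
    case True
    then have c: "card (insert y (\<eta> x)) \<le> 2" using fi xy by simp
    have "insert y (\<eta> x) \<subseteq> E `` {x}" using xy st by auto
    then obtain S where "insert y (\<eta> x) \<subseteq> S" "S \<subseteq> E `` {x}" "0 < p (card S)"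
      using extend_state[OF x _ c] by blast
    moreover have "L \<eta> - link x x = L \<eta>" using links_subset[OF T] not_self by auto
    ultimately have "redirect \<eta> x y S x" using inf x by (simp add: redirect_def)
    then show ?thesis by blast
  next
    case False
    then obtain w w' where w: "w \<in> \<eta> x" "w' \<in> \<eta> x" "w \<noteq> w'"
      by (metis One_nat_def card_le_Suc0_iff_eq fi)
    then have "\<exists>w\<in>\<eta> x. infinite ((L \<eta> - link x w)\<^sup>* `` {x})"
      using infinite_cluster_remove_one_of_two[OF sym_links w(3) inf] by blast
    then obtain w where w: "w \<in> \<eta> x" "infinite ((L \<eta> - link x w)\<^sup>* `` {x})" by blast
    \<comment> \<open>The swap keeps the size of the state, so positivity is inherited from \<eta>,
      whatever the support of p.\<close>
    let ?S = "insert y (\<eta> x - {w})"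
    have "card ?S = card (\<eta> x)"
      using fi w xy card_Suc_Diff1[of "\<eta> x" w] by simp
    then have "0 < p (card ?S)" using state_pos[OF T x] by simp
    moreover have "?S \<subseteq> E `` {x}" using st xy by blast
    moreover have "w \<in> V" "w \<noteq> x" "w \<noteq> y" using w st xy E_subset not_self by blast+
    ultimately have "redirect \<eta> x y ?S w"
      using w by (simp add: redirect_def)
    then show ?thesis by blast
  qed
qed

lemma redirect_upd: "\<eta> \<in> T \<Longrightarrow> x \<in> V \<Longrightarrow> redirect \<eta> x y S w \<Longrightarrow> \<eta>(x := S) \<in> T"
  by (auto simp: redirect_def intro: upd)

lemma redirect_links:
  assumes "redirect \<eta> x y S w"
  shows "L \<eta> - link x w \<subseteq> L (\<eta>(x := S))"
proof (rule links_mono_except[OF sym_link])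
  have "\<eta> x - {w} \<subseteq> S" using assms unfolding redirect_def by blast
  then show "b \<in> (\<eta>(x := S)) a" if "b \<in> \<eta> a" "(a, b) \<notin> link x w" for a b
    using that by (cases "a = x") auto
qed

text \<open>Induction on the distance. If no adjacent pair were separated, an infinite cluster could
  be extended by one step along a walk from x to y, giving a closer separated pair.\<close>

lemma separated_adjacent:
  assumes "separated \<eta> x y" "(x, y) \<in> E ^^ n"
  shows "\<exists>\<eta> x y. separated \<eta> x y \<and> (x, y) \<in> E"
  using assms
proof (induction n arbitrary: \<eta> x y rule: less_induct)
  case (less n)
  note sep = less.prems(1)
  show ?case
  proof (rule ccontr)
    assume contra: "\<not> ?case"
    have T: "\<eta> \<in> T" and V: "x \<in> V" "y \<in> V" using sep by (auto simp: separated_def)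
    have "n \<noteq> 0"
    proof
      assume "n = 0"
      then have "x = y" using less.prems(2) by simp
      then show False using sep separated_irrefl by simp
    qed
    then obtain m where n: "n = Suc m" using not0_implies_Suc by blast
    then obtain z where z: "(x, z) \<in> E" "(z, y) \<in> E ^^ m"
      using relpow_Suc_D2 less.prems(2)[unfolded n] by metis
    have zV: "z \<in> V" using z E_subset by auto
    have zx: "(z, x) \<in> E" using z sym_E by (meson symD)
    have IH: "\<not> separated \<eta>' z y" for \<eta>'
    proof
      assume "separated \<eta>' z y"
      then have ?case by (rule less.IH[OF _ _ z(2), rotated]) (simp add: n)
      then show False by (rule contra[THEN notE])
    qed
    have nxz: "\<not> separated \<eta>' x u" if "(x, u) \<in> E" for \<eta>' u
    proof
      assume "separated \<eta>' x u"
      with that have ?case by (intro exI conjI)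
      then show False by (rule contra[THEN notE])
    qed
    \<comment> \<open>An infinite cluster at z would differ from that of x or from that of y. This
      gives an adjacent separated pair or one joined by a walk of length m.\<close>
    have fin_z: "finite ((L \<eta>')\<^sup>* `` {z})" if "separated \<eta>' x y" for \<eta>'
    proof (rule ccontr)
      assume "infinite ((L \<eta>')\<^sup>* `` {z})"
      from separated_cases[OF that zV this] IH nxz[OF z(1)] show False by simp
    qed
    have "{x} \<subseteq> E `` {z}" "card {x} \<le> 2" using zx by simp_all
    then obtain Z where Z': "{x} \<subseteq> Z" "Z \<subseteq> E `` {z}" "0 < p (card Z)"
      by (rule extend_state[OF zV])
    then have Z: "x \<in> Z" "Z \<subseteq> E `` {z}" "0 < p (card Z)" by simp_all
    \<comment> \<open>First \<open>z\<close> is made to point to \<open>x\<close>, which is harmless as \<open>z\<close> lies in a finite cluster; then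
      \<open>x\<close> is redirected to \<open>z\<close>, and \<open>z\<close> replaces \<open>x\<close> at distance \<open>m\<close> from \<open>y\<close>.\<close>
    define \<eta>1 where "\<eta>1 = \<eta>(z := Z)"
    have T1: "\<eta>1 \<in> T" unfolding \<eta>1_def by (rule upd[OF T zV Z(2,3)])
    \<comment> \<open>The new state of z may close old links at z, so the comparison starts from the
      links that avoid z; they have the same infinite clusters.\<close>
    define R where "R = L \<eta> - {e. fst e = z \<or> snd e = z}"
    have nz: "(z, u) \<notin> (L \<eta>)\<^sup>*" if "infinite ((L \<eta>)\<^sup>* `` {u})" for u
    proof
      assume "(z, u) \<in> (L \<eta>)\<^sup>*"
      then have "(L \<eta>)\<^sup>* `` {z} = (L \<eta>)\<^sup>* `` {u}" by (simp only: cluster_eq_iff[OF sym_links])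
      then show False using fin_z[OF sep] that by argo
    qed
    have R: "R\<^sup>* `` {u} = (L \<eta>)\<^sup>* `` {u}" if "infinite ((L \<eta>)\<^sup>* `` {u})" for u
      unfolding R_def by (rule cluster_isolate_other[OF sym_links nz[OF that]])
    have Rxy: "R\<^sup>* `` {x} = (L \<eta>)\<^sup>* `` {x}" "R\<^sup>* `` {y} = (L \<eta>)\<^sup>* `` {y}"
      by (rule R; use sep in \<open>simp add: separated_def\<close>)+
    have sep1: "separated \<eta>1 x y"
    proof (rule separated_mono[of _ R])
      show "sym R" unfolding R_def by (rule symI) (auto dest: symD[OF sym_links])
      show "R \<subseteq> L \<eta>1"
      proof (rule subrelI)
        fix a b assume "(a, b) \<in> R"
        then have "a \<noteq> z" "b \<noteq> z" "(a, b) \<in> L \<eta>" by (simp_all add: R_def)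
        then show "(a, b) \<in> L \<eta>1" by (simp add: links_upd_iff \<eta>1_def)
      qed
      show "finite (L \<eta>1 - R)"
      proof (rule finite_diff_upd2(1)[OF T1 zV zV])
        fix a b assume "a \<notin> {z, z}" "b \<notin> {z, z}" "(a, b) \<in> L \<eta>1"
        then show "(a, b) \<in> R" by (simp add: links_upd_iff \<eta>1_def R_def)
      qed
      show "finite (infinite_clusters V R)" "card (infinite_clusters V R) \<le> k"
        unfolding R_def infinite_clusters_isolate[OF sym_links fin_z[OF sep]]
        using fin[OF T] card_k[OF T] by simp_all
      show "(x, y) \<notin> R\<^sup>*" using Rxy(1) sep by (auto simp: separated_def)
      show "infinite (R\<^sup>* `` {x})" "infinite (R\<^sup>* `` {y})"
        using sep by (simp_all add: Rxy separated_def)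
    qed (use T1 V in simp_all)
    have x1: "x \<in> \<eta>1 z" by (simp add: \<eta>1_def Z)
    have z1: "z \<notin> \<eta>1 x"
    proof
      assume "z \<in> \<eta>1 x"
      then have "(x, z) \<in> L \<eta>1" using x1 V zV by (simp add: links_def)
      then have "(L \<eta>1)\<^sup>* `` {x} = (L \<eta>1)\<^sup>* `` {z}"
        unfolding cluster_eq_iff[OF sym_links] by (rule r_into_rtrancl)
      then show False using fin_z[OF sep1] sep1 by (simp add: separated_def)
    qed
    obtain S w where Sw: "redirect \<eta>1 x z S w"
      using redirect_exists[OF T1 z(1) z1] sep1 by (auto simp: separated_def)
    define \<eta>2 where "\<eta>2 = \<eta>1(x := S)"
    have T2: "\<eta>2 \<in> T" unfolding \<eta>2_def by (rule redirect_upd[OF T1 V(1) Sw])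
    have "(L \<eta>1 - link x w)\<^sup>* `` {x} \<subseteq> (L \<eta>2)\<^sup>* `` {x}"
      using rtrancl_mono[OF redirect_links[OF Sw]] by (auto simp: \<eta>2_def)
    then have x2: "infinite ((L \<eta>2)\<^sup>* `` {x})"
      using Sw by (auto simp: redirect_def dest: finite_subset)
    \<comment> \<open>No vertex u of the cluster of y is adjacent to x, since x and u would be an
      adjacent separated pair. So redirecting x cannot touch this cluster.\<close>
    have y2: "(L \<eta>2)\<^sup>* `` {y} = (L \<eta>1)\<^sup>* `` {y}"
    proof (rule cluster_cong)
      fix u v assume "u \<in> (L \<eta>1)\<^sup>* `` {y}"
      then have u: "(y, u) \<in> (L \<eta>1)\<^sup>*" by simp
      have ux: "u \<noteq> x" using u separated_commute[OF sep1] by (auto simp: separated_def)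
      have uV: "u \<in> V" using u V(2) by (cases rule: rtranclE) (auto simp: links_def)
      have "(L \<eta>1)\<^sup>* `` {y} = (L \<eta>1)\<^sup>* `` {u}" by (simp only: cluster_eq_iff[OF sym_links] u)
      moreover have "(u, y) \<in> (L \<eta>1)\<^sup>*" using u by (rule rtrancl_sym_iff[OF sym_links, THEN iffD1])
      then have "(x, u) \<notin> (L \<eta>1)\<^sup>*"
        using sep1 rtrancl_trans[of x u "L \<eta>1" y] unfolding separated_def by blast
      ultimately have "separated \<eta>1 x u"
        using sep1 uV by (simp add: separated_def)
      then have "(x, u) \<notin> E" using nxz by metis
      then have "(u, x) \<notin> E" using sym_E by (meson symD)
      then have "(u, x) \<notin> L \<eta>1" "(u, x) \<notin> L \<eta>2"
        using links_subset[OF T1] links_subset[OF T2] by blast+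
      then show "(u, v) \<in> L \<eta>1 \<longleftrightarrow> (u, v) \<in> L \<eta>2"
        using ux by (cases "v = x") (auto simp: \<eta>2_def links_upd_iff)
    qed
    have "(x, z) \<in> L \<eta>2"
    proof -
      have "z \<in> S" using Sw by (simp add: redirect_def)
      moreover have "x \<noteq> z" using z(1) not_self by blast
      ultimately show ?thesis using x1 V zV by (simp add: links_def \<eta>2_def)
    qed
    then have xz: "(L \<eta>2)\<^sup>* `` {x} = (L \<eta>2)\<^sup>* `` {z}"
      unfolding cluster_eq_iff[OF sym_links] by (rule r_into_rtrancl)
    have "x \<notin> (L \<eta>2)\<^sup>* `` {y}"
      unfolding y2 using separated_commute[OF sep1] by (simp add: separated_def)
    then have "y \<notin> (L \<eta>2)\<^sup>* `` {x}" using rtrancl_sym_iff[OF sym_links, of x y s V \<eta>2] by simp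
    then have "(z, y) \<notin> (L \<eta>2)\<^sup>*" unfolding xz by simp
    moreover have "infinite ((L \<eta>2)\<^sup>* `` {y})" unfolding y2 using sep1 by (simp add: separated_def)
    moreover have "infinite ((L \<eta>2)\<^sup>* `` {z})" using x2 unfolding xz .
    ultimately have "separated \<eta>2 z y"
      using T2 zV V by (simp add: separated_def)
    then show False using IH by blast
  qed
qed

text \<open>\<open>R\<close> drops both links that may be lost. These belong to different clusters,
  so their effects on the count add up. The weak and the strong case share this accounting.\<close>

lemma redirect_both:
  assumes sep: "separated \<eta> x y" and r: "redirect \<eta> x y S w" "redirect \<eta> y x S' v"
  defines "R \<equiv> L \<eta> - link x w - link y v"
  shows "sym R" "finite (infinite_clusters V R)"
    and "card (infinite_clusters V R) + k =
      card (infinite_clusters V (L \<eta> - link x w)) + card (infinite_clusters V (L \<eta> - link y v))"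
    and "(x, y) \<notin> R\<^sup>*" "infinite (R\<^sup>* `` {x})" "infinite (R\<^sup>* `` {y})"
    and "\<eta>(x := S, y := S') \<in> T" "R \<subseteq> L (\<eta>(x := S, y := S'))"
    and "finite (L (\<eta>(x := S, y := S')) - R)"
proof -
  have T: "\<eta> \<in> T" and V: "x \<in> V" "y \<in> V" "w \<in> V" "v \<in> V" and n: "(x, y) \<notin> (L \<eta>)\<^sup>*"
    using sep r by (auto simp: separated_def redirect_def)
  have xy: "x \<noteq> y" using n by blast
  show s: "sym R" unfolding R_def by (intro sym_remove_link sym_links)
  show "card (infinite_clusters V R) + k =
      card (infinite_clusters V (L \<eta> - link x w)) + card (infinite_clusters V (L \<eta> - link y v))"
    unfolding R_def
    using card_infinite_clusters_remove_links[OF sym_links V(1,3,2,4) n fin[OF T]] card_k[OF T] by simp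
  have sub: "(L \<eta> - A)\<^sup>* \<subseteq> (L \<eta>)\<^sup>*" for A by (rule rtrancl_mono) blast
  have R': "R = L \<eta> - link y v - link x w" and RU: "R = L \<eta> - (link x w \<union> link y v)"
    by (auto simp: R_def)
  show "(x, y) \<notin> R\<^sup>*"
    using n sub[of "link x w \<union> link y v"] unfolding RU by blast
  have "(y, x) \<notin> (L \<eta> - link x w)\<^sup>*" "(x, y) \<notin> (L \<eta> - link y v)\<^sup>*"
    using n sub rtrancl_sym_iff[OF sym_links, of x y s V \<eta>] by blast+
  then have "R\<^sup>* `` {x} = (L \<eta> - link x w)\<^sup>* `` {x}" "R\<^sup>* `` {y} = (L \<eta> - link y v)\<^sup>* `` {y}"
    unfolding R_def
    using cluster_remove_other_link[OF sym_remove_link[OF sym_links]] R'[unfolded R_def] by metis+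
  then show "infinite (R\<^sup>* `` {x})" "infinite (R\<^sup>* `` {y})" using r by (simp_all add: redirect_def)
  have T1: "\<eta>(x := S) \<in> T" by (rule redirect_upd[OF T V(1) r(1)])
  show T2: "\<eta>(x := S, y := S') \<in> T"
    by (rule upd[OF T1 V(2)]) (use r in \<open>auto simp: redirect_def\<close>)
  show "R \<subseteq> L (\<eta>(x := S, y := S'))"
  proof -
    have "\<eta> x - {w} \<subseteq> S" "\<eta> y - {v} \<subseteq> S'" using r unfolding redirect_def by blast+
    then have "b \<in> (\<eta>(x := S, y := S')) a" if "b \<in> \<eta> a" "(a, b) \<notin> link x w \<union> link y v" for a b
      using that by (cases "a = x"; cases "a = y") auto
    then have "L \<eta> - (link x w \<union> link y v) \<subseteq> L (\<eta>(x := S, y := S'))"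
      by (intro links_mono_except sym_Un sym_link)
    then show ?thesis unfolding RU .
  qed
  show "finite (L (\<eta>(x := S, y := S')) - R)"
  proof (rule finite_diff_upd2(1)[OF T2 V(1,2)])
    fix a b assume ab: "a \<notin> {x, y}" "b \<notin> {x, y}" and "(a, b) \<in> L (\<eta>(x := S, y := S'))"
    then have "(a, b) \<in> L \<eta>" by (simp add: links_upd_iff)
    with ab show "(a, b) \<in> R" by (simp add: R_def)
  qed
  show "finite (infinite_clusters V R)"
  proof (cases "(x, w) \<in> L \<eta> - link y v")
    case True
    then have "R \<union> link x w = L \<eta> - link y v"
      using symD[OF sym_remove_link[OF sym_links] True] by (auto simp: R')
    then show ?thesis
      using card_infinite_clusters_add_link(1)[OF s V(1,3)] card_remove_link[OF T V(2,4)] by simp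
  next
    case False
    then have "R = L \<eta> - link y v"
      using symD[OF sym_remove_link[OF sym_links], of w x s V \<eta> y v] by (auto simp: R')
    then show ?thesis using card_remove_link[OF T V(2,4)] by simp
  qed
qed

text \<open>
  Redirecting only \<open>x\<close> to \<open>y\<close> joins two infinite clusters, so the lost link must have split one;
  the same holds for \<open>y\<close>. Redirecting both splits twice but joins only once.
\<close>

lemma no_separated_adjacent_weak:
  assumes s: "\<not> s" and sep: "separated \<eta> x y" and E: "(x, y) \<in> E"
  shows False
proof -
  have swap: "w \<in> \<eta> x \<and> S = insert y (\<eta> x - {w}) \<and> x \<notin> \<eta> w \<and> w \<noteq> x \<and>
      k < card (infinite_clusters V (L \<eta> - link x w))"
    if sep: "separated \<eta> x y" and E: "(x, y) \<in> E" and r: "redirect \<eta> x y S w" for x y S w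
  proof -
    have T: "\<eta> \<in> T" and V: "x \<in> V" "y \<in> V" "w \<in> V" and n: "(x, y) \<notin> (L \<eta>)\<^sup>*"
      using sep r by (auto simp: separated_def redirect_def)
    have T1: "\<eta>(x := S) \<in> T" by (rule redirect_upd[OF T V(1) r])
    have xy: "(x, y) \<in> L (\<eta>(x := S))"
    proof -
      have "y \<in> S" using r by (simp add: redirect_def)
      moreover have "x \<noteq> y" using E not_self by blast
      ultimately show ?thesis using s V by (simp add: links_def)
    qed
    \<comment> \<open>If no link were lost, constancy of the count would keep x and y separated
      although they are now linked.\<close>
    have nle: "\<not> L \<eta> \<subseteq> L (\<eta>(x := S))"
      using separated_upd_mono[OF sep T1 V(1)] separated_not_link xy by blast
    let ?Q = "L \<eta> - link x w"
    have sQ: "sym ?Q" by (intro sym_remove_link sym_links)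
    have sub: "?Q\<^sup>* \<subseteq> (L \<eta>)\<^sup>*" by (rule rtrancl_mono) blast
    have finQ: "finite (infinite_clusters V ?Q)" by (rule card_remove_link[OF T V(1,3)])
    have sQ': "sym (?Q \<union> link x y)" by (rule sym_add_link[OF sQ])
    have D: "finite (L (\<eta>(x := S)) - (?Q \<union> link x y))" "L (\<eta>(x := S)) - (?Q \<union> link x y) \<subseteq> V \<times> V"
      by (rule finite_diff_upd2[OF T1 V(1) V(1)]; simp add: links_upd_iff)+
    have Q: "?Q \<union> link x y \<subseteq> L (\<eta>(x := S))"
      using redirect_links[OF r] xy symD[OF sym_links xy] by blast
    have "k \<le> card (infinite_clusters V (?Q \<union> link x y))"
      using card_infinite_clusters_mono(2)[OF sQ' sym_links Q D] card_k[OF T1]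
        card_infinite_clusters_add_link(1)[OF sQ V(1,2)] finQ by simp
    also have "\<dots> < card (infinite_clusters V ?Q)"
    proof -
      have "infinite (?Q\<^sup>* `` {x})" using r by (simp add: redirect_def)
      moreover have "infinite (?Q\<^sup>* `` {y})"
        using cluster_remove_other_link[OF sym_links n, of w] sep by (simp add: separated_def)
      moreover have "(x, y) \<notin> ?Q\<^sup>*" using n sub by blast
      ultimately show ?thesis
        using card_infinite_clusters_add_link(2)[OF sQ V(1,2) finQ] by simp
    qed
    finally have less: "k < card (infinite_clusters V ?Q)" .
    have neq: "w \<noteq> x"
    proof
      assume "w = x"
      then have "?Q = L \<eta>" using links_subset[OF T] not_self by auto
      then show False using less card_k[OF T] by simp
    qed
    then have w: "w \<in> \<eta> x" "S = insert y (\<eta> x - {w})"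
      using r by (auto simp: redirect_def)
    \<comment> \<open>An arrow from w to x would hold the weak link open, and again nothing would be
      lost.\<close>
    moreover have "x \<notin> \<eta> w"
    proof
      assume "x \<in> \<eta> w"
      then have "L \<eta> \<subseteq> L (\<eta>(x := S))"
        using w s neq by (auto simp: links_def split: if_splits)
      then show False using nle by blast
    qed
    ultimately show ?thesis using less neq by blast
  qed
  have yx: "separated \<eta> y x" "(y, x) \<in> E"
    using separated_commute[OF sep] symD[OF sym_E E] by auto
  have T: "\<eta> \<in> T" and V: "x \<in> V" "y \<in> V"
    using sep by (auto simp: separated_def)
  have nl: "(x, y) \<notin> L \<eta>" using separated_not_link[OF sep] .
  then have "y \<notin> \<eta> x" "x \<notin> \<eta> y" using s V by (auto simp: links_def)
  then obtain S w S' v where r: "redirect \<eta> x y S w" "redirect \<eta> y x S' v"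
    using redirect_exists[OF T E] redirect_exists[OF T yx(2)] sep unfolding separated_def by blast
  note both = redirect_both[OF sep r]
  note w = swap[OF sep E r(1)] and v = swap[OF yx r(2)]
  define R where "R = L \<eta> - link x w - link y v"
  let ?\<eta> = "\<eta>(x := S, y := S')"
  have xy: "x \<noteq> y" using E not_self by blast
  \<comment> \<open>Both redirections are pure swaps and neither lost link is held open from its
    other end, so the link between x and y is the only one that can be added to
    \<open>R\<close>.\<close>
  have "L ?\<eta> \<subseteq> R \<union> link x y"
  proof
    fix e assume "e \<in> L ?\<eta>"
    then obtain a b where e: "e = (a, b)" "a \<in> V" "b \<in> V" "b \<in> ?\<eta> a \<or> a \<in> ?\<eta> b"
      using s by (auto simp: links_def)
    have *: "(a, b) \<in> R \<union> link x y" if "a \<in> V" "b \<in> V" "b \<in> ?\<eta> a" for a b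
    proof (cases "(a, b) \<in> link x y")
      case False
      have "b \<in> \<eta> a" using that w v False by (auto split: if_splits)
      moreover have "(a, b) \<notin> link x w" "(a, b) \<notin> link y v"
        using that w v False xy \<open>b \<in> \<eta> a\<close> by (auto split: if_splits)
      ultimately show ?thesis using that s by (auto simp: R_def links_def)
    next
      case True
      then show ?thesis by blast
    qed
    have "sym (R \<union> link x y)" unfolding R_def by (intro sym_add_link sym_remove_link sym_links)
    with *[of a b] *[of b a] e show "e \<in> R \<union> link x y" by (meson symD)
  qed
  moreover have "sym (R \<union> link x y)" unfolding R_def by (intro sym_add_link sym_remove_link sym_links)
  moreover have D: "R \<union> link x y - L ?\<eta> \<subseteq> link x y"
    using both(8) by (auto simp: R_def)
  moreover from D have "finite (R \<union> link x y - L ?\<eta>)" "R \<union> link x y - L ?\<eta> \<subseteq> V \<times> V"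
    using V by (auto intro: finite_subset)
  ultimately have "card (infinite_clusters V (R \<union> link x y)) \<le> k"
    using card_infinite_clusters_mono(2)[OF sym_links, of "R \<union> link x y" s V ?\<eta> V]
      fin[OF both(7)] card_k[OF both(7)] by simp
  moreover have "card (infinite_clusters V R) \<le> Suc (card (infinite_clusters V (R \<union> link x y)))"
    using card_infinite_clusters_add_link(2)[OF both(1) V both(2)] unfolding R_def[symmetric] by simp
  \<comment> \<open>Each deletion alone leaves at least k + 1 infinite clusters, so \<open>R\<close>
    has at least k + 2. Joining x and y removes at most one of them, yet at most k remain.\<close>
  ultimately show False
    using both(3)[folded R_def] w v by linarith
qed

text \<open>
  If neither of \<open>x\<close> and \<open>y\<close> points to the other, redirecting one of them opens no link, so the lost
  link does not split an infinite cluster. Redirecting both then joins two clusters for free.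
\<close>

lemma no_separated_adjacent_strong:
  assumes s: s and sep: "separated \<eta> x y" and E: "(x, y) \<in> E"
  shows False
proof (cases "0 < p d")
  case True
  have T: "\<eta> \<in> T" and V: "x \<in> V" "y \<in> V" using sep by (auto simp: separated_def)
  have xy: "x \<noteq> y" using E not_self by blast
  have full: "\<eta>(z := E `` {z}) \<in> T \<and> L \<eta> \<subseteq> L (\<eta>(z := E `` {z}))" if "\<eta> \<in> T" "z \<in> V" for \<eta> z
  proof
    show "\<eta>(z := E `` {z}) \<in> T" by (rule upd) (use that True regular in auto)
    show "L \<eta> \<subseteq> L (\<eta>(z := E `` {z}))" using s state[OF that] by (auto simp: links_def)
  qed
  let ?\<eta>1 = "\<eta>(x := E `` {x})"
  let ?\<eta>2 = "?\<eta>1(y := E `` {y})"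
  have "separated ?\<eta>1 x y" using separated_upd_mono[OF sep _ V(1)] full[OF T V(1)] by blast
  moreover have "?\<eta>1 \<in> T" using full[OF T V(1)] by blast
  ultimately have "separated ?\<eta>2 x y" using separated_upd_mono[OF _ _ V(2)] full[OF _ V(2)] by blast
  moreover have "(x, y) \<in> L ?\<eta>2" using s V E xy symD[OF sym_E E] by (simp add: links_def)
  ultimately show False using separated_not_link by blast
next
  case False
  \<comment> \<open>As x and y are not strongly linked, an arrow from x to y carries no link. Moving
    it elsewhere keeps the size of the state and loses nothing.\<close>
  have drop: "\<exists>\<eta>'. separated \<eta>' x y \<and> y \<notin> \<eta>' x \<and> \<eta>' y = \<eta> y"
    if sep: "separated \<eta> x y" and E: "(x, y) \<in> E" for \<eta> x y
  proof (cases "y \<in> \<eta> x")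
    case True
    have T: "\<eta> \<in> T" and V: "x \<in> V" "y \<in> V" using sep by (auto simp: separated_def)
    have xy: "x \<noteq> y" using E not_self by blast
    have "x \<notin> \<eta> y" using separated_not_link[OF sep] True s V by (simp add: links_def)
    have "card (\<eta> x) \<noteq> d" using False state_pos[OF T V(1)] by auto
    then have "\<eta> x \<noteq> E `` {x}" using regular[OF V(1)] by auto
    then obtain u where u: "u \<in> E `` {x}" "u \<notin> \<eta> x" using state[OF T V(1)] by blast
    let ?\<eta> = "\<eta>(x := insert u (\<eta> x - {y}))"
    have "finite (\<eta> x)" using state[OF T V(1)] finite_nbrs[OF V(1)] by (rule finite_subset)
    then have "card (insert u (\<eta> x - {y})) = card (\<eta> x)"
      using u True card_Suc_Diff1[of "\<eta> x" y] by simp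
    then have "?\<eta> \<in> T" using T V state_pos[OF T V(1)] state[OF T V(1)] u by (intro upd) auto
    moreover have "L \<eta> \<subseteq> L ?\<eta>" using s \<open>x \<notin> \<eta> y\<close> by (auto simp: links_def)
    ultimately have "separated ?\<eta> x y" using separated_upd_mono[OF sep _ V(1)] by blast
    moreover have "y \<notin> ?\<eta> x" "?\<eta> y = \<eta> y" using u True xy by auto
    ultimately show ?thesis by blast
  qed (use sep in blast)
  obtain \<eta>1 where 1: "separated \<eta>1 x y" "y \<notin> \<eta>1 x" using drop[OF sep E] by blast
  have E': "(y, x) \<in> E" using symD[OF sym_E E] .
  obtain \<eta> where "separated \<eta> y x" and nx: "x \<notin> \<eta> y" and "\<eta> x = \<eta>1 x"
    using drop[OF separated_commute[OF 1(1)] E'] by blast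
  then have sep: "separated \<eta> x y" and sep': "separated \<eta> y x" and ny: "y \<notin> \<eta> x"
    using 1 separated_commute by auto
  have T: "\<eta> \<in> T" and V: "x \<in> V" "y \<in> V" using sep by (auto simp: separated_def)
  have xy: "x \<noteq> y" using E not_self by blast
  have le: "card (infinite_clusters V (L \<eta> - link x w)) \<le> k"
    if V: "x \<in> V" and r: "redirect \<eta> x y S w" and nx: "x \<notin> \<eta> y" "x \<noteq> y" for x y S w
  proof (cases "w = x")
    case True
    then have "L \<eta> - link x w = L \<eta>" using links_subset[OF T] not_self by auto
    then show ?thesis using card_k[OF T] by simp
  next
    case False
    then have S: "S = insert y (\<eta> x - {w})" "w \<noteq> y" "w \<in> V" using r by (auto simp: redirect_def)
    have T1: "\<eta>(x := S) \<in> T" by (rule redirect_upd[OF T V r])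
    \<comment> \<open>The arrow to y opens no strong link because x \<notin> \<eta> y. So the
      right-hand side is the larger relation, and its count is at most that of the updated
      configuration, which is k.\<close>
    have sub: "L (\<eta>(x := S)) \<subseteq> L \<eta> - link x w"
      using S s nx by (auto simp: links_def split: if_splits)
    have sub': "L \<eta> - link x w - L (\<eta>(x := S)) \<subseteq> {e \<in> E. fst e = x \<or> snd e = x}"
      using links_subset[OF T] links_upd_iff[of _ x _ s V \<eta> S] by fastforce
    have "card (infinite_clusters V (L \<eta> - link x w)) \<le> card (infinite_clusters V (L (\<eta>(x := S))))"
    proof (rule card_infinite_clusters_mono(2)[OF sym_links sym_remove_link[OF sym_links] sub])
      show "finite (L \<eta> - link x w - L (\<eta>(x := S)))" by (rule finite_subset[OF sub' finite_incident[OF V]])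
      show "L \<eta> - link x w - L (\<eta>(x := S)) \<subseteq> V \<times> V" using sub' E_subset by blast
    qed (rule fin[OF T1])
    then show ?thesis using card_k[OF T1] by simp
  qed
  obtain S w S' v where r: "redirect \<eta> x y S w" "redirect \<eta> y x S' v"
    using redirect_exists[OF T E ny] redirect_exists[OF T E' nx] sep unfolding separated_def by blast
  note both = redirect_both[OF sep r]
  have "card (infinite_clusters V (L \<eta> - link x w - link y v)) \<le> k"
    using both(3) le[OF V(1) r(1) nx xy] le[OF V(2) r(2) ny xy[symmetric]] by linarith
  then have "separated (\<eta>(x := S, y := S')) x y"
    using separated_mono[OF both(7,1,8,9,2) _ V both(5,6,4)] by blast
  moreover have "(x, y) \<in> L (\<eta>(x := S, y := S'))"
  proof -
    have "y \<in> S" "x \<in> S'" using r by (simp_all add: redirect_def)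
    then show ?thesis using s V xy by (simp add: links_def)
  qed
  ultimately show False using separated_not_link by blast
qed

lemma no_separated: "\<not> separated \<eta> x y"
proof
  assume sep: "separated \<eta> x y"
  then have "(x, y) \<in> E\<^sup>*" using connected by (simp add: separated_def)
  then obtain n where "(x, y) \<in> E ^^ n" by (auto simp: rtrancl_power)
  then obtain \<eta> x y where "separated \<eta> x y" "(x, y) \<in> E"
    using separated_adjacent[OF sep] by blast
  then show False using no_separated_adjacent_weak no_separated_adjacent_strong by blast
qed

end

section \<open>Out-degree at most one\<close>

text \<open>Follow the \<open>F\<close>-path up to its first step outside \<open>F'\<close>; that
  step starts at a vertex which already reaches z by \<open>F'\<close>.\<close>

lemma rtrancl_first_hit:
  assumes "(v, z) \<in> F\<^sup>*" "\<And>a b. (a, b) \<in> F \<Longrightarrow> (a, z) \<in> F'\<^sup>* \<or> (a, b) \<in> F'"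
  shows "(v, z) \<in> F'\<^sup>*"
  using assms(1)
proof (induction rule: converse_rtrancl_induct)
  case (step a b)
  then show ?case using assms(2)[OF step(1)] by (auto intro: converse_rtrancl_into_rtrancl)
qed simp

locale closed_configs_functional = closed_configs V E d p s k T
  for V :: "'v set" and E d p s k T +
  assumes weak: "\<not> s" and p1: "0 < p 1"
    and outdeg: "\<eta> \<in> T \<Longrightarrow> x \<in> V \<Longrightarrow> card (\<eta> x) \<le> 1"
    and finite_orbit: "\<eta> \<in> T \<Longrightarrow> x \<in> V \<Longrightarrow> finite ((open_edges V \<eta>)\<^sup>* `` {x})"
begin

lemma open_edges_functional:
  assumes "\<eta> \<in> T" "(a, b) \<in> open_edges V \<eta>" "(a, b') \<in> open_edges V \<eta>"
  shows "b = b'"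
proof -
  have a: "a \<in> V" "b \<in> \<eta> a" "b' \<in> \<eta> a" using assms by (auto simp: open_edges_def)
  moreover have "finite (\<eta> a)" using state[OF assms(1) a(1)] finite_nbrs[OF a(1)] by (rule finite_subset)
  ultimately show ?thesis using outdeg[OF assms(1) a(1)] by (auto simp: card_le_Suc0_iff_eq)
qed

lemma links_eq_open_edges: "\<eta> \<in> T \<Longrightarrow> L \<eta> = open_edges V \<eta> \<union> (open_edges V \<eta>)\<inverse>"
  using weak state E_subset by (fastforce simp: links_def open_edges_def)

lemma upd_single: "\<eta> \<in> T \<Longrightarrow> (a, b) \<in> E \<Longrightarrow> \<eta>(a := {b}) \<in> T"
  using E_subset p1 by (intro upd) auto

text \<open>When orbits are finite and out-degrees at most one, these are the sink of a cluster or
  the vertices of its terminal cycle.\<close>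

definition root :: "('v \<Rightarrow> 'v set) \<Rightarrow> 'v \<Rightarrow> bool" where
  "root \<eta> z \<longleftrightarrow> (\<forall>u \<in> (L \<eta>)\<^sup>* `` {z}. (u, z) \<in> (open_edges V \<eta>)\<^sup>*)"

text \<open>
  With out-degree at most one, the set of vertices whose forward orbit meets \<open>z\<close> can only be left
  along the edge that starts in \<open>z\<close>.
\<close>

lemma rootI:
  assumes T: "\<eta> \<in> T" and z: "\<And>b. (z, b) \<in> open_edges V \<eta> \<Longrightarrow> (b, z) \<in> (open_edges V \<eta>)\<^sup>*"
  shows "root \<eta> z"
  unfolding root_def
proof
  fix u assume "u \<in> (L \<eta>)\<^sup>* `` {z}"
  then have "(z, u) \<in> (L \<eta>)\<^sup>*" by simp
  then show "(u, z) \<in> (open_edges V \<eta>)\<^sup>*"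
  proof (induction rule: rtrancl_induct)
    case (step a b)
    then consider "(a, b) \<in> open_edges V \<eta>" | "(b, a) \<in> open_edges V \<eta>"
      using links_eq_open_edges[OF T] by blast
    then show ?case
    proof cases
      case 1
      from step(3) show ?thesis
      proof (cases rule: converse_rtranclE)
        case base
        with 1 z show ?thesis by simp
      next
        case (step c)
        then show ?thesis using open_edges_functional[OF T 1 step(1)] by simp
      qed
    next
      case 2
      then show ?thesis using step(3) by (rule converse_rtrancl_into_rtrancl)
    qed
  qed simp
qed

text \<open>Take a vertex on the forward orbit of x whose own forward orbit is smallest: a successor
  has the same orbit and therefore leads back.\<close>

lemma root_exists:
  assumes T: "\<eta> \<in> T" and x: "x \<in> V"
  obtains z where "(x, z) \<in> (open_edges V \<eta>)\<^sup>*" "root \<eta> z"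
proof -
  let ?F = "open_edges V \<eta>"
  obtain z where z: "(x, z) \<in> ?F\<^sup>*"
    and least: "\<And>u. (x, u) \<in> ?F\<^sup>* \<Longrightarrow> card (?F\<^sup>* `` {z}) \<le> card (?F\<^sup>* `` {u})"
    using ex_has_least_nat[of "\<lambda>u. (x, u) \<in> ?F\<^sup>*" x "\<lambda>u. card (?F\<^sup>* `` {u})"] by blast
  have "root \<eta> z"
  proof (rule rootI[OF T])
    fix b assume b: "(z, b) \<in> ?F"
    have "?F\<^sup>* `` {z} \<subseteq> ?F\<^sup>* `` {x}" using z by auto
    then have "finite (?F\<^sup>* `` {z})" using finite_orbit[OF T x] finite_subset by blast
    moreover have "?F\<^sup>* `` {b} \<subseteq> ?F\<^sup>* `` {z}" using b by (auto intro: converse_rtrancl_into_rtrancl)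
    moreover have "card (?F\<^sup>* `` {z}) \<le> card (?F\<^sup>* `` {b})"
      by (rule least) (rule rtrancl_into_rtrancl[OF z b])
    ultimately have "?F\<^sup>* `` {b} = ?F\<^sup>* `` {z}"
      using card_seteq by blast
    then show "(b, z) \<in> ?F\<^sup>*" by blast
  qed
  with z that show thesis by blast
qed

text \<open>A directed path to z can be stopped at its first arrival, before it uses the edge out of
  z. The empty state may have probability zero: \<open>\<eta>(z := {})\<close> serves only through
  its links and is not claimed to lie in \<open>T\<close>.\<close>

lemma root_remove_out_edge:
  assumes T: "\<eta> \<in> T" and root: "root \<eta> z"
  shows "(L (\<eta>(z := {})))\<^sup>* = (L \<eta>)\<^sup>*"
proof (rule antisym)
  let ?F = "open_edges V \<eta>" and ?G = "open_edges V (\<eta>(z := {}))"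
  have GL: "?G \<subseteq> L (\<eta>(z := {}))"
    using weak state[OF T] E_subset by (fastforce simp: links_def open_edges_def split: if_splits)
  have reach: "(u, z) \<in> (L (\<eta>(z := {})))\<^sup>*" if "(z, u) \<in> (L \<eta>)\<^sup>*" for u
  proof -
    have "(u, z) \<in> ?F\<^sup>*" using root that by (simp add: root_def)
    then have "(u, z) \<in> ?G\<^sup>*"
      by (rule rtrancl_first_hit) (auto simp: open_edges_def)
    then show ?thesis using rtrancl_mono[OF GL] by blast
  qed
  have "(a, b) \<in> (L (\<eta>(z := {})))\<^sup>*" if "(a, b) \<in> L \<eta>" for a b
  proof (cases "a = z \<or> b = z")
    case True
    then have "(z, a) \<in> (L \<eta>)\<^sup>*" "(z, b) \<in> (L \<eta>)\<^sup>*" using that symD[OF sym_links that] by auto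
    with reach rtrancl_sym_iff[OF sym_links, of b z s V "\<eta>(z := {})"] show ?thesis
      by (meson rtrancl_trans)
  next
    case False
    then have "(a, b) \<in> L (\<eta>(z := {}))" using that by (simp add: links_upd_iff)
    then show ?thesis by (rule r_into_rtrancl)
  qed
  then show "(L \<eta>)\<^sup>* \<subseteq> (L (\<eta>(z := {})))\<^sup>*" by (intro rtrancl_subset_rtrancl) auto
  have "L (\<eta>(z := {})) \<subseteq> L \<eta>" using weak by (auto simp: links_def split: if_splits)
  then show "(L (\<eta>(z := {})))\<^sup>* \<subseteq> (L \<eta>)\<^sup>*" by (rule rtrancl_mono)
qed

text \<open>Otherwise pointing z to u would join two infinite clusters at no cost, as the old edge
  out of a root can be given up freely.\<close>

lemma root_adjacent:
  assumes sep: "separated \<eta> z y" and root: "root \<eta> z" and E: "(z, u) \<in> E"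
  shows "(u, y) \<notin> (L \<eta>)\<^sup>*"
proof
  assume uy: "(u, y) \<in> (L \<eta>)\<^sup>*"
  have T: "\<eta> \<in> T" and V: "z \<in> V" "y \<in> V" using sep by (auto simp: separated_def)
  let ?R = "L (\<eta>(z := {}))" and ?\<eta> = "\<eta>(z := {u})"
  have R: "?R\<^sup>* = (L \<eta>)\<^sup>*" by (rule root_remove_out_edge[OF T root])
  have T': "?\<eta> \<in> T" by (rule upd_single[OF T E])
  have sub: "?R \<subseteq> L ?\<eta>" using weak by (auto simp: links_def split: if_splits)
  have "separated ?\<eta> z y"
  proof (rule separated_mono[OF T' sym_links sub])
    show "finite (L ?\<eta> - ?R)"
      by (rule finite_diff_upd2(1)[OF T' V(1) V(1)]) (simp add: links_upd_iff)
  qed (use R fin[OF T] card_k[OF T] sep in \<open>simp_all add: separated_def infinite_clusters_def\<close>)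
  moreover have "(z, u) \<in> L ?\<eta>" using weak E E_subset by (auto simp: links_def)
  then have "(z, y) \<in> (L ?\<eta>)\<^sup>*"
    using uy[folded R] rtrancl_mono[OF sub] by (meson converse_rtrancl_into_rtrancl subsetD)
  ultimately show False by (simp add: separated_def)
qed

text \<open>The two-cycle makes u a root. Old paths into z that pass through u now step to z at
  once, so the cluster of z survives whole. Since neither u nor z belongs to the cluster of y, that
  cluster is unchanged.\<close>

lemma root_move:
  assumes sep: "separated \<eta> z y" and root: "root \<eta> z" and E: "(z, u) \<in> E"
  defines "\<eta>' \<equiv> \<eta>(u := {z}, z := {u})"
  shows "separated \<eta>' u y \<and> root \<eta>' u"
proof -
  have T: "\<eta> \<in> T" and V: "z \<in> V" "y \<in> V" "u \<in> V" using sep E E_subset by (auto simp: separated_def)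
  have ne: "u \<noteq> z" using E irrefl_E by (auto simp: irrefl_def)
  have E': "(u, z) \<in> E" using symD[OF sym_E E] .
  have T': "\<eta>' \<in> T" unfolding \<eta>'_def by (intro upd_single T E E')
  let ?F = "open_edges V \<eta>" and ?F' = "open_edges V \<eta>'"
  have F': "(u, b) \<in> ?F' \<longleftrightarrow> b = z" "(z, b) \<in> ?F' \<longleftrightarrow> b = u" for b
    using V ne by (auto simp: open_edges_def \<eta>'_def)
  have FL: "?F' \<subseteq> L \<eta>'" using links_eq_open_edges[OF T'] by blast
  have "(z, u) \<in> ?F'\<^sup>*" using F'(2)[of u] by blast
  then have "root \<eta>' u" by (intro rootI[OF T']) (simp add: F')
  moreover have "separated \<eta>' u y"
  proof -
    have uy: "(y, u) \<notin> (L \<eta>)\<^sup>*"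
      using root_adjacent[OF sep root E] rtrancl_sym_iff[OF sym_links, of y u s V \<eta>] by simp
    have zy: "(y, z) \<notin> (L \<eta>)\<^sup>*"
      using sep rtrancl_sym_iff[OF sym_links, of y z s V \<eta>] by (simp add: separated_def)
    have y: "(L \<eta>')\<^sup>* `` {y} = (L \<eta>)\<^sup>* `` {y}"
    proof (rule cluster_cong)
      fix a b assume "a \<in> (L \<eta>)\<^sup>* `` {y}"
      then have a: "(y, a) \<in> (L \<eta>)\<^sup>*" by simp
      then have na: "a \<noteq> u" "a \<noteq> z" using uy zy by auto
      show "(a, b) \<in> L \<eta> \<longleftrightarrow> (a, b) \<in> L \<eta>'"
      proof (cases "b \<in> {u, z}")
        case True
        then have "(a, b) \<notin> L \<eta>" using a uy zy by (auto dest: rtrancl_into_rtrancl)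
        moreover have "(a, b) \<notin> L \<eta>'"
        proof
          assume ab: "(a, b) \<in> L \<eta>'"
          then have "b \<in> \<eta>' a" using True na weak ne by (auto simp: links_def \<eta>'_def)
          then have "(a, b) \<in> L \<eta>" using na weak ab by (auto simp: links_def \<eta>'_def)
          then show False using \<open>(a, b) \<notin> L \<eta>\<close> by blast
        qed
        ultimately show ?thesis by simp
      next
        case False
        then show ?thesis using na by (simp add: \<eta>'_def links_upd_iff)
      qed
    qed
    have "(L \<eta>)\<^sup>* `` {z} \<subseteq> (L \<eta>')\<^sup>* `` {u}"
    proof
      fix v assume "v \<in> (L \<eta>)\<^sup>* `` {z}"
      then have "(v, z) \<in> ?F\<^sup>*" using root by (simp add: root_def)
      then have "(v, z) \<in> ?F'\<^sup>*"
      proof (rule rtrancl_first_hit)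
        fix a b assume "(a, b) \<in> ?F"
        then show "(a, z) \<in> ?F'\<^sup>* \<or> (a, b) \<in> ?F'"
          using F'(1)[of z] by (cases "a \<in> {u, z}") (auto simp: open_edges_def \<eta>'_def)
      qed
      then have "(v, u) \<in> ?F'\<^sup>*" using F'(2)[of u] by (auto intro: rtrancl_into_rtrancl)
      then have "(v, u) \<in> (L \<eta>')\<^sup>*" using rtrancl_mono[OF FL] by blast
      then show "v \<in> (L \<eta>')\<^sup>* `` {u}" using rtrancl_sym_iff[OF sym_links, of v u s V \<eta>'] by simp
    qed
    then have "infinite ((L \<eta>')\<^sup>* `` {u})" using sep by (auto simp: separated_def dest: finite_subset)
    moreover have "(u, y) \<notin> (L \<eta>')\<^sup>*"
    proof -
      have "u \<notin> (L \<eta>')\<^sup>* `` {y}" unfolding y using uy by simp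
      then show ?thesis using rtrancl_sym_iff[OF sym_links, of u y s V \<eta>'] by simp
    qed
    moreover have "infinite ((L \<eta>')\<^sup>* `` {y})" unfolding y using sep by (simp add: separated_def)
    ultimately show ?thesis using T' V by (simp add: separated_def)
  qed
  ultimately show ?thesis by blast
qed

lemma no_separated_functional: "\<not> separated \<eta> x y"
proof
  assume sep: "separated \<eta> x y"
  then have T: "\<eta> \<in> T" and V: "x \<in> V" "y \<in> V" by (auto simp: separated_def)
  obtain z where z: "(x, z) \<in> (open_edges V \<eta>)\<^sup>*" "root \<eta> z"
    by (rule root_exists[OF T V(1)])
  have "open_edges V \<eta> \<subseteq> L \<eta>" using links_eq_open_edges[OF T] by blast
  then have xz: "(x, z) \<in> (L \<eta>)\<^sup>*" using z(1) rtrancl_mono by blast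
  have zV: "z \<in> V" using xz V(1) by (cases rule: rtranclE) (auto simp: links_def)
  have eq: "(L \<eta>)\<^sup>* `` {x} = (L \<eta>)\<^sup>* `` {z}" by (simp only: cluster_eq_iff[OF sym_links] xz)
  have "y \<notin> (L \<eta>)\<^sup>* `` {x}" using sep by (simp add: separated_def)
  then have "(z, y) \<notin> (L \<eta>)\<^sup>*" unfolding eq by simp
  then have sepz: "separated \<eta> z y"
    using sep zV eq unfolding separated_def by simp
  have *: False if "separated \<eta> z y" "root \<eta> z" "(z, y) \<in> E ^^ n" for \<eta> z n
    using that
  proof (induction n arbitrary: \<eta> z)
    case 0
    then show ?case using separated_irrefl by simp
  next
    case (Suc n)
    from relpow_Suc_D2[OF Suc.prems(3)] obtain u where u: "(z, u) \<in> E" "(u, y) \<in> E ^^ n" by blast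
    show ?case
      using root_move[OF Suc.prems(1,2) u(1)] Suc.IH u(2) by blast
  qed
  have "(z, y) \<in> E\<^sup>*" using connected zV V by simp
  then obtain n where "(z, y) \<in> E ^^ n" by (auto simp: rtrancl_power)
  with * sepz z(2) show False by blast
qed

end

section \<open>The product measure\<close>

locale random_digraph = transitive_digraph V E d
  for V :: "'v set" and E d +
  fixes p :: "nat \<Rightarrow> real"
  assumes p: "degree_distribution d p"
begin

abbreviation M :: "'v \<Rightarrow> 'v set measure" where
  "M x \<equiv> point_measure (Pow (E `` {x})) (\<lambda>S. ennreal (p (card S) / real (d choose card S)))"

abbreviation P :: "('v \<Rightarrow> 'v set) measure" where
  "P \<equiv> Pi\<^sub>M V M"

lemma config_measure_eq: "config_measure V E d p = P"
  by (simp add: config_measure_def)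

lemma nbrs_subset: "E `` {x} \<subseteq> V"
  using E_subset by auto

lemma card_state_le: "x \<in> V \<Longrightarrow> S \<subseteq> E `` {x} \<Longrightarrow> card S \<le> d"
  using card_mono[OF finite_nbrs] regular by metis

lemma p_nonneg: "x \<in> V \<Longrightarrow> S \<subseteq> E `` {x} \<Longrightarrow> 0 \<le> p (card S)"
  using p card_state_le by (auto simp: degree_distribution_def)

lemma prob_space_M:
  assumes x: "x \<in> V" shows "prob_space (M x)"
proof (rule prob_space_point_measure)
  let ?A = "E `` {x}"
  have fin: "finite ?A" and card: "card ?A = d" using finite_nbrs[OF x] regular[OF x] by auto
  have "(\<Sum>S\<in>Pow ?A. p (card S) / real (d choose card S)) =
      (\<Sum>i\<le>d. \<Sum>S\<in>{S \<in> Pow ?A. card S = i}. p (card S) / real (d choose card S))"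
    by (rule sum.group[symmetric]) (use fin card card_mono[OF fin] in auto)
  also have "\<dots> = (\<Sum>i\<le>d. p i)"
  proof (rule sum.cong[OF refl])
    fix i assume i: "i \<in> {..d}"
    have "(\<Sum>S\<in>{S \<in> Pow ?A. card S = i}. p (card S) / real (d choose card S)) =
        (\<Sum>S\<in>{S \<in> Pow ?A. card S = i}. p i / real (d choose i))" by (rule sum.cong) auto
    also have "\<dots> = p i" using n_subsets[OF fin, of i] card i by simp
    finally show "(\<Sum>S\<in>{S \<in> Pow ?A. card S = i}. p (card S) / real (d choose card S)) = p i" .
  qed
  also have "\<dots> = 1" using p by (simp add: degree_distribution_def)
  finally show "(\<Sum>S\<in>Pow ?A. ennreal (p (card S) / real (d choose card S))) = 1"
    using p_nonneg[OF x] by (subst sum_ennreal) auto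
qed (use finite_nbrs[OF x] in auto)

sublocale P: prob_space P
  by (rule prob_space_PiM) (rule prob_space_M)

lemma state_pos_iff: "x \<in> V \<Longrightarrow> S \<subseteq> E `` {x} \<Longrightarrow>
    0 < ennreal (p (card S) / real (d choose card S)) \<longleftrightarrow> 0 < p (card S)"
  using card_state_le[of x S] by (simp add: zero_less_divide_iff)

lemma space_P: "\<eta> \<in> space P \<longleftrightarrow> (\<forall>x\<in>V. \<eta> x \<subseteq> E `` {x}) \<and> \<eta> \<in> extensional V"
  by (auto simp: space_PiM PiE_def Pi_def space_point_measure)

lemma AE_state_pos: "AE \<eta> in P. \<forall>x\<in>V. 0 < p (card (\<eta> x))"
proof (rule AE_ball_countable[THEN iffD2, OF countable_V], rule ballI)
  fix x assume x: "x \<in> V"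
  have "AE S in M x. 0 < p (card S)"
    using state_pos_iff[OF x] by (auto simp: AE_point_measure)
  then show "AE \<eta> in P. 0 < p (card (\<eta> x))"
    by (rule AE_PiM_component[OF prob_space_M x, rotated])
qed

text \<open>By Fubini the property holds for almost every state s at x and almost every choice X
  elsewhere. As S is an atom of positive mass, it holds at s = S for almost every X, and X has the
  law of \<eta> outside x.\<close>

lemma AE_upd:
  assumes Q: "AE \<eta> in P. Q \<eta>" and x: "x \<in> V" and S: "S \<subseteq> E `` {x}" "0 < p (card S)"
  shows "AE \<eta> in P. Q (\<eta>(x := S))"
proof -
  let ?R = "Pi\<^sub>M (V - {x}) M"
  have V: "insert x (V - {x}) = V" using x by auto
  interpret Mx: prob_space "M x" by (rule prob_space_M[OF x])
  interpret R: prob_space ?R by (rule prob_space_PiM) (simp add: prob_space_M)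
  interpret pair_sigma_finite "M x" ?R ..
  have eq: "distr (M x \<Otimes>\<^sub>M ?R) P (\<lambda>(s, X). X(x := s)) = P"
    using distr_pair_PiM_eq_PiM[of "V - {x}" M x] prob_space_M x unfolding V by auto
  have "AE z in distr (M x \<Otimes>\<^sub>M ?R) P (\<lambda>(s, X). X(x := s)). Q z" unfolding eq by (rule Q)
  moreover have "(\<lambda>(s, X). X(x := s)) \<in> measurable (M x \<Otimes>\<^sub>M ?R) P"
    using measurable_add_dim[of x "V - {x}" M] unfolding V
    by (simp add: measurable_pair_swap_iff[of _ "M x"] case_prod_unfold)
  ultimately have "AE z in M x \<Otimes>\<^sub>M ?R. Q ((\<lambda>(s, X). X(x := s)) z)"
    by (rule AE_distrD[rotated])
  then have "AE s in M x. AE X in ?R. Q (X(x := s))"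
    using AE_pair by fastforce
  then have R: "AE X in ?R. Q (X(x := S))"
    using S state_pos_iff[OF x S(1)] by (simp add: AE_point_measure)
  have eq2: "distr P ?R (\<lambda>\<eta>. restrict \<eta> (V - {x})) = ?R"
    using distr_PiM_reindex[of V M "\<lambda>i. i" "V - {x}"] prob_space_M by (simp add: restrict_def)
  have "AE X in distr P ?R (\<lambda>\<eta>. restrict \<eta> (V - {x})). Q (X(x := S))" unfolding eq2 by (rule R)
  then have "AE \<eta> in P. Q ((restrict \<eta> (V - {x}))(x := S))"
    by (rule AE_distrD[rotated]) (rule measurable_restrict_subset, blast)
  moreover have "(restrict \<eta> (V - {x}))(x := S) = \<eta>(x := S)" if "\<eta> \<in> space P" for \<eta>
    using that unfolding space_P by (auto simp: extensional_def fun_eq_iff)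
  ultimately show ?thesis by (auto elim: AE_mp intro!: AE_I2)
qed

text \<open>
  An almost sure property remains almost sure after any number of single-vertex updates; the
  configurations for which it does so form the required set.
\<close>

lemma closed_set_exists:
  assumes Q: "AE \<eta> in P. Q \<eta>"
  shows "\<exists>T. T \<noteq> {} \<and> T \<subseteq> space P \<and> (\<forall>\<eta>\<in>T. Q \<eta> \<and> (\<forall>x\<in>V. 0 < p (card (\<eta> x)))) \<and>
    (\<forall>\<eta>\<in>T. \<forall>x\<in>V. \<forall>S. S \<subseteq> E `` {x} \<longrightarrow> 0 < p (card S) \<longrightarrow> \<eta>(x := S) \<in> T)"
proof -
  \<comment> \<open>\<open>U n\<close> demands the property after every sequence of exactly n
    updates, so the intersection over n is closed under updates. Each stage costs only countably
    many null sets.\<close>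
  define U where "U = rec_nat (\<lambda>\<eta>. Q \<eta> \<and> (\<forall>x\<in>V. 0 < p (card (\<eta> x))))
    (\<lambda>_ R \<eta>. \<forall>x\<in>V. \<forall>S\<in>{S \<in> Pow (E `` {x}). 0 < p (card S)}. R (\<eta>(x := S)))"
  have U0: "U 0 \<eta> \<longleftrightarrow> Q \<eta> \<and> (\<forall>x\<in>V. 0 < p (card (\<eta> x)))" for \<eta> by (simp add: U_def)
  have US: "U (Suc n) \<eta> \<longleftrightarrow> (\<forall>x\<in>V. \<forall>S\<in>{S \<in> Pow (E `` {x}). 0 < p (card S)}. U n (\<eta>(x := S)))"
    for n \<eta> by (simp add: U_def)
  have AE: "AE \<eta> in P. U n \<eta>" for n
  proof (induction n)
    case 0
    then show ?case unfolding U0 using Q AE_state_pos by eventually_elim simp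
  next
    case (Suc n)
    have "AE \<eta> in P. \<forall>S\<in>{S \<in> Pow (E `` {x}). 0 < p (card S)}. U n (\<eta>(x := S))" if x: "x \<in> V" for x
    proof (rule AE_ball_countable[THEN iffD2])
      show "countable {S \<in> Pow (E `` {x}). 0 < p (card S)}"
        using finite_nbrs[OF x] by (intro countable_finite) simp
      show "\<forall>S\<in>{S \<in> Pow (E `` {x}). 0 < p (card S)}. AE \<eta> in P. U n (\<eta>(x := S))"
      proof
        fix S assume "S \<in> {S \<in> Pow (E `` {x}). 0 < p (card S)}"
        then show "AE \<eta> in P. U n (\<eta>(x := S))" by (intro AE_upd[OF Suc x]) auto
      qed
    qed
    then show ?case unfolding US by (intro AE_ball_countable[THEN iffD2, OF countable_V]) blast
  qed
  define T where "T = {\<eta> \<in> space P. \<forall>n. U n \<eta>}"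
  have "AE \<eta> in P. \<forall>n. U n \<eta>" using AE by (simp add: AE_all_countable)
  then have ne: "T \<noteq> {}"
  proof (rule contrapos_pn)
    assume "T = {}"
    then have "AE \<eta> in P. \<not> (\<forall>n. U n \<eta>)" by (intro AE_I2) (auto simp: T_def)
    then show "\<not> (AE \<eta> in P. \<forall>n. U n \<eta>)" using P.AE_contr by blast
  qed
  have closed: "\<eta>(x := S) \<in> T"
    if "\<eta> \<in> T" "x \<in> V" "S \<subseteq> E `` {x}" "0 < p (card S)" for \<eta> x S
  proof -
    have "\<eta>(x := S) \<in> space P" using that by (auto simp: T_def space_P extensional_def)
    moreover have "U n (\<eta>(x := S))" for n
      using that US[of n \<eta>] by (simp add: T_def)
    ultimately show ?thesis by (simp add: T_def)
  qed
  show ?thesis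
  proof (intro exI conjI ballI allI impI)
    fix \<eta> assume "\<eta> \<in> T"
    then have "U 0 \<eta>" by (simp add: T_def)
    then show "Q \<eta>" "\<And>x. x \<in> V \<Longrightarrow> 0 < p (card (\<eta> x))" by (simp_all add: U0)
  qed (use ne closed in \<open>auto simp: T_def\<close>)
qed

end

section \<open>Measurability and invariance of the number of infinite clusters\<close>

lemma enat_le_ecard_iff: "enat j \<le> ecard K \<longleftrightarrow> (\<exists>K'\<subseteq>K. finite K' \<and> card K' = j)"
proof (cases "finite K")
  case True
  show ?thesis
  proof
    assume "enat j \<le> ecard K"
    then have "j \<le> card K" using True by (simp add: ecard_def)
    then show "\<exists>K'\<subseteq>K. finite K' \<and> card K' = j"
      using obtain_subset_with_card_n by metis
  qed (use True card_mono in \<open>auto simp: ecard_def\<close>)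
next
  case False
  then show ?thesis using infinite_arbitrarily_large[OF False, of j] by (auto simp: ecard_def)
qed

lemma ecard_image: "inj_on f A \<Longrightarrow> ecard (f ` A) = ecard A"
  by (simp add: ecard_def card_image finite_image_iff)

text \<open>Clusters are replaced by representatives: V has only countably many finite subsets,
  while a cluster could be any of uncountably many subsets. Measurability of the count follows from
  this form.\<close>

lemma enat_le_infinite_clusters_iff:
  assumes R: "sym R"
  shows "enat j \<le> ecard (infinite_clusters V R) \<longleftrightarrow>
    (\<exists>D\<in>{D. D \<subseteq> V \<and> finite D \<and> card D = j}.
      (\<forall>x\<in>D. infinite (R\<^sup>* `` {x})) \<and> (\<forall>x\<in>D. \<forall>y\<in>D. x \<noteq> y \<longrightarrow> (x, y) \<notin> R\<^sup>*))"
    (is "_ \<longleftrightarrow> ?rhs")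
proof
  assume "enat j \<le> ecard (infinite_clusters V R)"
  then obtain K where K: "K \<subseteq> infinite_clusters V R" "finite K" "card K = j"
    by (auto simp: enat_le_ecard_iff)
  then have "\<forall>C\<in>K. \<exists>x. x \<in> V \<and> C = R\<^sup>* `` {x} \<and> infinite C"
    by (meson infinite_clusters_iff subsetD)
  then obtain g where g: "\<And>C. C \<in> K \<Longrightarrow> g C \<in> V \<and> C = R\<^sup>* `` {g C} \<and> infinite C"
    by metis
  then have inj: "inj_on g K" by (metis inj_onI)
  show ?rhs
  proof (intro bexI[of _ "g ` K"] conjI ballI impI)
    fix x y assume "x \<in> g ` K" "y \<in> g ` K" "x \<noteq> y"
    then show "(x, y) \<notin> R\<^sup>*" using g cluster_eq_iff[OF R] by (metis imageE)
  next
    fix x assume "x \<in> g ` K"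
    then show "infinite (R\<^sup>* `` {x})" using g by (metis imageE)
  qed (use g K inj in \<open>auto simp: card_image\<close>)
next
  assume ?rhs
  then obtain D where D: "D \<subseteq> V" "finite D" "card D = j" "\<forall>x\<in>D. infinite (R\<^sup>* `` {x})"
    "\<forall>x\<in>D. \<forall>y\<in>D. x \<noteq> y \<longrightarrow> (x, y) \<notin> R\<^sup>*" by auto
  have "inj_on (\<lambda>x. R\<^sup>* `` {x}) D" using D(5) cluster_eq_iff[OF R] by (meson inj_onI)
  then have "card ((\<lambda>x. R\<^sup>* `` {x}) ` D) = j" using D by (simp add: card_image)
  moreover have "(\<lambda>x. R\<^sup>* `` {x}) ` D \<subseteq> infinite_clusters V R"
    using D by (auto intro: cluster_in_infinite_clusters)
  ultimately show "enat j \<le> ecard (infinite_clusters V R)"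
    unfolding enat_le_ecard_iff using D(2) by blast
qed

lemma rtrancl_iso:
  assumes f: "bij_betw f V V" and R: "R \<subseteq> V \<times> V" "R' \<subseteq> V \<times> V"
    and iso: "\<And>x y. x \<in> V \<Longrightarrow> y \<in> V \<Longrightarrow> (f x, f y) \<in> R' \<longleftrightarrow> (x, y) \<in> R"
    and x: "x \<in> V"
  shows "R'\<^sup>* `` {f x} = f ` (R\<^sup>* `` {x})"
proof (intro equalityI subsetI)
  fix z assume "z \<in> R'\<^sup>* `` {f x}"
  then have "(f x, z) \<in> R'\<^sup>*" by simp
  then show "z \<in> f ` (R\<^sup>* `` {x})"
  proof (induction rule: rtrancl_induct)
    case (step u v)
    then obtain u' where u': "u = f u'" "(x, u') \<in> R\<^sup>*" by auto
    have "u' \<in> V" using u'(2) x R(1) by (cases rule: rtranclE) auto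
    moreover obtain v' where "v' \<in> V" "v = f v'"
      using step(2) R(2) f by (metis SigmaD2 bij_betw_imp_surj_on imageE subsetD)
    ultimately show ?case using step(2) u' iso by (auto intro: rtrancl_into_rtrancl)
  qed simp
next
  fix z assume "z \<in> f ` (R\<^sup>* `` {x})"
  then obtain z' where z: "z = f z'" "(x, z') \<in> R\<^sup>*" by auto
  from z(2) have "(f x, f z') \<in> R'\<^sup>*"
  proof (induction rule: rtrancl_induct)
    case (step u v)
    then have "(f u, f v) \<in> R'" using iso R(1) by auto
    with step show ?case by simp
  qed simp
  then show "z \<in> R'\<^sup>* `` {f x}" using z by simp
qed

lemma ecard_infinite_clusters_iso:
  assumes f: "bij_betw f V V" and R: "R \<subseteq> V \<times> V" "R' \<subseteq> V \<times> V"
    and iso: "\<And>x y. x \<in> V \<Longrightarrow> y \<in> V \<Longrightarrow> (f x, f y) \<in> R' \<longleftrightarrow> (x, y) \<in> R"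
  shows "ecard (infinite_clusters V R') = ecard (infinite_clusters V R)"
proof -
  note cl = rtrancl_iso[OF f R iso]
  have sub: "R\<^sup>* `` {x} \<subseteq> V" if "x \<in> V" for x
    using that R(1) by (auto elim: rtranclE)
  have inf: "infinite (f ` (R\<^sup>* `` {x})) \<longleftrightarrow> infinite (R\<^sup>* `` {x})" if "x \<in> V" for x
    using finite_image_iff[OF inj_on_subset[OF bij_betw_imp_inj_on[OF f] sub[OF that]]] by simp
  have "infinite_clusters V R' = (`) f ` infinite_clusters V R"
  proof (rule set_eqI)
    fix C
    have "C \<in> infinite_clusters V R' \<longleftrightarrow> (\<exists>x\<in>f ` V. C = R'\<^sup>* `` {x} \<and> infinite C)"
      using f by (simp add: infinite_clusters_iff bij_betw_def)
    also have "\<dots> \<longleftrightarrow> (\<exists>x\<in>V. C = f ` (R\<^sup>* `` {x}) \<and> infinite (R\<^sup>* `` {x}))"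
      using cl inf by auto
    also have "\<dots> \<longleftrightarrow> C \<in> (`) f ` infinite_clusters V R"
      unfolding image_iff Bex_def infinite_clusters_iff by metis
    finally show "C \<in> infinite_clusters V R' \<longleftrightarrow> C \<in> (`) f ` infinite_clusters V R" .
  qed
  moreover have "inj_on ((`) f) (infinite_clusters V R)"
  proof (rule inj_on_subset)
    show "inj_on ((`) f) (Pow V)" using f by (simp add: bij_betw_imp_inj_on inj_on_image_Pow)
    show "infinite_clusters V R \<subseteq> Pow V"
    proof
      fix C assume "C \<in> infinite_clusters V R"
      then show "C \<in> Pow V" using sub unfolding infinite_clusters_iff by blast
    qed
  qed
  ultimately show ?thesis by (simp add: ecard_image)
qed

context random_digraph
begin

lemma sets_state: "x \<in> V \<Longrightarrow> {\<eta> \<in> space P. Q (\<eta> x)} \<in> sets P"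
  by (rule sets_Collect_single') (auto simp: sets_point_measure space_point_measure)

lemma sets_links: "{\<eta> \<in> space P. (x, y) \<in> links s V \<eta>} \<in> sets P"
proof (cases "x \<in> V \<and> y \<in> V")
  case True
  have "{\<eta> \<in> space P. (x, y) \<in> links s V \<eta>} =
    (if s then {\<eta> \<in> space P. y \<in> \<eta> x} \<inter> {\<eta> \<in> space P. x \<in> \<eta> y}
     else {\<eta> \<in> space P. y \<in> \<eta> x} \<union> {\<eta> \<in> space P. x \<in> \<eta> y})"
    using True by (auto simp: links_def)
  also have "\<dots> \<in> sets P"
    using True sets_state[of x "\<lambda>S. y \<in> S"] sets_state[of y "\<lambda>S. x \<in> S"] by auto
  finally show ?thesis .
next
  case False
  then have "{\<eta> \<in> space P. (x, y) \<in> links s V \<eta>} = {}" by (auto simp: links_def)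
  then show ?thesis by (simp only: sets.empty_sets)
qed

lemma links_subset_V: "links s V \<eta> \<subseteq> V \<times> V"
  by (auto simp: links_def)

lemma cluster_subset: "x \<in> V \<Longrightarrow> (links s V \<eta>)\<^sup>* `` {x} \<subseteq> V"
  by (auto elim: rtranclE simp: links_def)

lemma sets_connected: "{\<eta> \<in> space P. (x, y) \<in> (links s V \<eta>)\<^sup>*} \<in> sets P"
proof -
  have n: "{\<eta> \<in> space P. (x, y) \<in> links s V \<eta> ^^ n} \<in> sets P" for n
  proof (induction n arbitrary: y)
    case (Suc n)
    have "{\<eta> \<in> space P. (x, y) \<in> links s V \<eta> ^^ Suc n} =
      {\<eta> \<in> space P. \<exists>z\<in>V. (x, z) \<in> links s V \<eta> ^^ n \<and> (z, y) \<in> links s V \<eta>}"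
      using links_subset_V by fastforce
    also have "\<dots> \<in> sets P"
      by (intro sets.sets_Collect_countable_Ex' sets.sets_Collect_conj Suc sets_links countable_V)
    finally show ?case .
  qed (auto cong: conj_cong)
  show ?thesis unfolding rtrancl_power by (intro sets.sets_Collect_countable_Ex n)
qed

lemma sets_infinite_cluster:
  assumes x: "x \<in> V"
  shows "{\<eta> \<in> space P. infinite ((links s V \<eta>)\<^sup>* `` {x})} \<in> sets P"
proof -
  \<comment> \<open>Being infinite is phrased as leaving every finite subset of V, which involves
    only countable quantifiers.\<close>
  have *: "infinite ((links s V \<eta>)\<^sup>* `` {x}) \<longleftrightarrow>
    (\<forall>F\<in>{F. F \<subseteq> V \<and> finite F}. \<exists>y\<in>V - F. (x, y) \<in> (links s V \<eta>)\<^sup>*)" (is "infinite ?C \<longleftrightarrow> ?rhs") for \<eta>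
  proof
    assume inf: "infinite ?C"
    show ?rhs
    proof
      fix F assume "F \<in> {F. F \<subseteq> V \<and> finite F}"
      then have "infinite (?C - F)" using inf by simp
      then obtain y where "y \<in> ?C - F" using infinite_imp_nonempty by blast
      then show "\<exists>y\<in>V - F. (x, y) \<in> (links s V \<eta>)\<^sup>*" using cluster_subset[OF x, of s \<eta>] by auto
    qed
  next
    assume ?rhs
    then show "infinite ?C" using cluster_subset[OF x, of s \<eta>] by blast
  qed
  have "countable {F. F \<subseteq> V \<and> finite F}"
    using countable_Collect_finite_subset[OF countable_V] by (simp add: conj_commute)
  then show ?thesis unfolding *
    using countable_V by (intro sets.sets_Collect_countable_All' sets.sets_Collect_countable_Ex' sets_connected) auto
qed

lemma sets_num_infinite_clusters:
  "{\<eta> \<in> space P. ecard (infinite_clusters V (links s V \<eta>)) = c} \<in> sets P"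
proof -
  have ge: "{\<eta> \<in> space P. enat j \<le> ecard (infinite_clusters V (links s V \<eta>))} \<in> sets P" for j
  proof -
    have "countable {F. finite F \<and> F \<subseteq> V}" by (rule countable_Collect_finite_subset[OF countable_V])
    then have c: "countable {D. D \<subseteq> V \<and> finite D \<and> card D = j}" by (rule countable_subset[rotated]) auto
    show ?thesis unfolding enat_le_infinite_clusters_iff[OF sym_links]
      by (intro sets.sets_Collect_countable_Ex'[OF _ c] sets.sets_Collect_conj
          sets.sets_Collect_countable_All' sets.sets_Collect_imp sets.sets_Collect_neg
          sets.sets_Collect_const sets_connected sets_infinite_cluster)
        (auto intro: countable_finite)
  qed
  show ?thesis
  proof (cases c)
    case (enat k)
    have "ecard K = enat k \<longleftrightarrow> enat k \<le> ecard K \<and> \<not> enat (Suc k) \<le> ecard K" for K :: "'v set set"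
      by (cases "ecard K") auto
    then show ?thesis unfolding enat by (auto intro!: sets.sets_Collect_conj sets.sets_Collect_neg ge)
  next
    case infinity
    have "ecard K = \<infinity> \<longleftrightarrow> (\<forall>j. enat j \<le> ecard K)" for K :: "'v set set"
      by (cases "ecard K") (auto simp: not_le intro: exI[of _ "Suc _"])
    then show ?thesis unfolding infinity by (auto intro!: sets.sets_Collect_countable_All ge)
  qed
qed

end

section \<open>The zero-one law for automorphism-invariant events\<close>

lemma (in prob_space) abs_prob_diff_le:
  assumes "A \<in> events" "B \<in> events"
  shows "\<bar>prob A - prob B\<bar> \<le> prob (sym_diff A B)"
proof -
  have 1: "prob X \<le> prob Y + prob (sym_diff X Y)" if "X \<in> events" "Y \<in> events" for X Y
  proof -
    have "prob X \<le> prob (Y \<union> sym_diff X Y)" using that by (intro finite_measure_mono) auto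
    also have "\<dots> \<le> prob Y + prob (sym_diff X Y)" using that by (intro measure_Un_le) auto
    finally show ?thesis .
  qed
  have "sym_diff B A = sym_diff A B" by blast
  with 1[OF assms] 1[OF assms(2,1)] show ?thesis by simp
qed

text \<open>The approximable sets form a sigma-algebra: a countable union is truncated, and the
  finitely many remaining sets are approximated one by one.\<close>

lemma (in prob_space) approx_by_algebra:
  assumes G: "algebra (space M) G" and sets: "sets M = sigma_sets (space M) G"
    and A: "A \<in> events" and e: "0 < (e::real)"
  shows "\<exists>B\<in>G. prob (sym_diff A B) < e"
proof -
  interpret G: algebra "space M" G by fact
  have GE: "B \<in> G \<Longrightarrow> B \<in> events" for B using sets by (auto intro: sigma_sets.Basic)
  have "A \<in> sigma_sets (space M) G" using A sets by simp
  then show ?thesis using e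
  proof (induction arbitrary: e rule: sigma_sets.induct)
    case (Basic A)
    then show ?case by (intro bexI[of _ A]) auto
  next
    case Empty
    then show ?case by (intro bexI[of _ "{}"]) auto
  next
    case (Compl A)
    then obtain B where B: "B \<in> G" "prob (sym_diff A B) < e" by blast
    have "A \<subseteq> space M" using Compl.hyps sets.sets_into_space sets by auto
    then have "sym_diff (space M - A) (space M - B) = sym_diff A B"
      using G.space_closed B(1) by blast
    then show ?case using B by (intro bexI[of _ "space M - B"]) auto
  next
    case (Union A)
    have Ae: "A i \<in> events" for i using Union.hyps sets by auto
    let ?S = "\<lambda>m. \<Union>i<m. A i"
    have "(\<lambda>m. prob (?S m)) \<longlonglongrightarrow> prob (\<Union>m. ?S m)"
      by (rule finite_Lim_measure_incseq) (use Ae in \<open>auto simp: incseq_def intro: less_le_trans\<close>)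
    moreover have "(\<Union>m. ?S m) = (\<Union>i. A i)" by blast
    ultimately have "\<forall>\<^sub>F m in sequentially. prob (\<Union>i. A i) - e / 2 < prob (?S m)"
      using Union.prems by (intro order_tendstoD(1)[of _ "prob (\<Union>i. A i)"]) auto
    then obtain m where m: "prob (\<Union>i. A i) - e / 2 < prob (?S m)"
      by (auto simp: eventually_sequentially)
    \<comment> \<open>Truncation uses up e / 2, and the m approximations share the other half; the
      added 1 covers m = 0.\<close>
    define e' where "e' = e / (2 * (real m + 1))"
    have e': "0 < e'" using Union.prems by (simp add: e'_def)
    have "\<exists>B\<in>G. prob (sym_diff (A i) B) < e'" for i using Union.IH[OF e'] .
    then obtain B where B: "\<And>i. B i \<in> G" "\<And>i. prob (sym_diff (A i) (B i)) < e'" by metis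
    let ?B = "\<Union>i<m. B i"
    have BG: "?B \<in> G" using B(1) by (intro G.finite_UN) auto
    have Be: "B i \<in> events" for i using GE B(1) by blast
    have D: "sym_diff (A i) (B i) \<in> events" for i using Ae Be by auto
    have "prob (sym_diff (\<Union>i. A i) ?B) \<le>
        prob (((\<Union>i. A i) - ?S m) \<union> (\<Union>i<m. sym_diff (A i) (B i)))"
      using Ae Be D by (intro finite_measure_mono) auto
    also have "\<dots> \<le> prob ((\<Union>i. A i) - ?S m) + prob (\<Union>i<m. sym_diff (A i) (B i))"
      using Ae D by (intro measure_Un_le) auto
    also have "prob ((\<Union>i. A i) - ?S m) = prob (\<Union>i. A i) - prob (?S m)"
      using Ae by (intro finite_measure_Diff) auto
    also have "prob (\<Union>i<m. sym_diff (A i) (B i)) \<le> (\<Sum>i<m. prob (sym_diff (A i) (B i)))"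
      using D by (intro finite_measure_subadditive_finite) auto
    also have "\<dots> \<le> (\<Sum>i<m. e')" using B(2) by (intro sum_mono less_imp_le)
    also have "\<dots> \<le> e / 2"
      using Union.prems by (simp add: e'_def field_simps)
    finally have "prob (sym_diff (\<Union>i. A i) ?B) < e" using m by simp
    then show ?case using BG by blast
  qed
qed

section \<open>Cylinder events and their independence\<close>

context random_digraph
begin

definition cylinder :: "'v set \<Rightarrow> ('v \<Rightarrow> 'v set) set \<Rightarrow> ('v \<Rightarrow> 'v set) set" where
  "cylinder J B = {\<eta> \<in> space P. restrict \<eta> J \<in> B}"

lemma measurable_restrict_P: "J \<subseteq> V \<Longrightarrow> (\<lambda>\<eta>. restrict \<eta> J) \<in> measurable P (Pi\<^sub>M J M)"
  by (rule measurable_restrict_subset)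

lemma sets_cylinder: "J \<subseteq> V \<Longrightarrow> B \<in> sets (Pi\<^sub>M J M) \<Longrightarrow> cylinder J B \<in> sets P"
  using measurable_sets[OF measurable_restrict_P] by (simp add: cylinder_def vimage_def Int_def conj_commute)

definition cylinders :: "('v \<Rightarrow> 'v set) set set" where
  "cylinders = {cylinder J B |J B. finite J \<and> J \<subseteq> V \<and> B \<in> sets (Pi\<^sub>M J M)}"

lemma cylinder_extend:
  assumes "J \<subseteq> K" "K \<subseteq> V" "B \<in> sets (Pi\<^sub>M J M)"
  obtains B' where "B' \<in> sets (Pi\<^sub>M K M)" "cylinder J B = cylinder K B'"
proof
  let ?B = "(\<lambda>\<eta>. restrict \<eta> J) -` B \<inter> space (Pi\<^sub>M K M)"
  show "?B \<in> sets (Pi\<^sub>M K M)"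
    using assms by (intro measurable_sets[OF measurable_restrict_subset]) auto
  have "restrict \<eta> K \<in> space (Pi\<^sub>M K M)" if "\<eta> \<in> space P" for \<eta>
    using measurable_space[OF measurable_restrict_P that] assms by auto
  moreover have "restrict (restrict \<eta> K) J = restrict \<eta> J" for \<eta> :: "'v \<Rightarrow> 'v set"
    using assms by (simp add: Int_absorb1)
  ultimately show "cylinder J B = cylinder K ?B" by (auto simp: cylinder_def)
qed

lemma algebra_cylinders: "algebra (space P) cylinders"
proof (rule algebra_iff_Un[THEN iffD2], intro conjI ballI)
  show "cylinders \<subseteq> Pow (space P)" by (auto simp: cylinders_def cylinder_def)
  have "cylinder {} {} \<in> cylinders" unfolding cylinders_def by blast
  then show "{} \<in> cylinders" by (simp add: cylinder_def)
next
  fix X assume "X \<in> cylinders"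
  then obtain J B where X: "X = cylinder J B" "finite J" "J \<subseteq> V" "B \<in> sets (Pi\<^sub>M J M)"
    by (auto simp: cylinders_def)
  have "space P - X = cylinder J (space (Pi\<^sub>M J M) - B)"
    using measurable_space[OF measurable_restrict_P[OF X(3)]] by (auto simp: X(1) cylinder_def)
  then show "space P - X \<in> cylinders" using X unfolding cylinders_def by blast
next
  fix X Y assume "X \<in> cylinders" "Y \<in> cylinders"
  then obtain J B K C where X: "X = cylinder J B" "finite J" "J \<subseteq> V" "B \<in> sets (Pi\<^sub>M J M)"
    and Y: "Y = cylinder K C" "finite K" "K \<subseteq> V" "C \<in> sets (Pi\<^sub>M K M)"
    by (auto simp: cylinders_def)
  obtain B' where B': "B' \<in> sets (Pi\<^sub>M (J \<union> K) M)" "X = cylinder (J \<union> K) B'"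
    using cylinder_extend[of J "J \<union> K" B] X Y by auto
  obtain C' where C': "C' \<in> sets (Pi\<^sub>M (J \<union> K) M)" "Y = cylinder (J \<union> K) C'"
    using cylinder_extend[of K "J \<union> K" C] X Y by auto
  have "X \<union> Y = cylinder (J \<union> K) (B' \<union> C')" by (auto simp: B' C' cylinder_def)
  moreover have "B' \<union> C' \<in> sets (Pi\<^sub>M (J \<union> K) M)" using B' C' by auto
  ultimately show "X \<union> Y \<in> cylinders" using X Y unfolding cylinders_def by blast
qed

lemma sets_P_cylinders: "sets P = sigma_sets (space P) cylinders"
proof
  have "prod_algebra V M \<subseteq> cylinders"
  proof
    fix X assume "X \<in> prod_algebra V M"
    then obtain J A where X: "X = prod_emb V M J (Pi\<^sub>E J A)" "finite J" "J \<subseteq> V"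
      "\<And>i. i \<in> J \<Longrightarrow> A i \<in> sets (M i)"
      by (force elim!: prod_algebraE)
    have "X = cylinder J (Pi\<^sub>E J A)"
      by (auto simp: X(1) prod_emb_def cylinder_def space_PiM)
    moreover have "Pi\<^sub>E J A \<in> sets (Pi\<^sub>M J M)" using X by (intro sets_PiM_I_finite) auto
    ultimately show "X \<in> cylinders" using X unfolding cylinders_def by blast
  qed
  then show "sets P \<subseteq> sigma_sets (space P) cylinders"
    unfolding sets_PiM space_PiM by (intro sigma_sets_mono')
  show "sigma_sets (space P) cylinders \<subseteq> sets P"
    by (intro sets.sigma_sets_subset) (auto simp: cylinders_def sets_cylinder)
qed

text \<open>The joint law of the coordinates is the product of their laws, so they are independent,
  and so are disjoint blocks of them.\<close>

lemma indep_cylinders: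
  assumes J: "J \<subseteq> V" "K \<subseteq> V" "J \<inter> K = {}" and B: "B \<in> sets (Pi\<^sub>M J M)" "C \<in> sets (Pi\<^sub>M K M)"
  shows "P.prob (cylinder J B \<inter> cylinder K C) = P.prob (cylinder J B) * P.prob (cylinder K C)"
proof -
  have rv: "(\<lambda>\<eta>. \<eta> i) \<in> measurable P (M i)" if "i \<in> V" for i
    using that by (rule measurable_component_singleton)
  have "distr P P (\<lambda>\<eta>. \<lambda>i\<in>V. \<eta> i) = distr P P (\<lambda>\<eta>. \<eta>)"
    by (rule distr_cong) (auto simp: space_PiM PiE_def extensional_restrict)
  also have "\<dots> = Pi\<^sub>M V (\<lambda>i. distr P (M i) (\<lambda>\<eta>. \<eta> i))"
    unfolding distr_id using distr_PiM_component[of V M] prob_space_M by (intro PiM_cong) auto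
  finally have "P.indep_vars M (\<lambda>i \<eta>. \<eta> i) V"
    using infinite_V by (subst P.indep_vars_iff_distr_eq_PiM'[OF _ rv]) auto
  from P.indep_var_restrict[OF this J(3,1,2)]
  have "P.indep_var (Pi\<^sub>M J M) (\<lambda>\<eta>. restrict \<eta> J) (Pi\<^sub>M K M) (\<lambda>\<eta>. restrict \<eta> K)" .
  from P.indep_varD[OF this B]
  show ?thesis by (simp add: cylinder_def vimage_def Int_def conj_ac Collect_conj_eq[symmetric])
qed

end

section \<open>The action of automorphisms on configurations\<close>

context random_digraph
begin

text \<open>A state moves together with its vertex, so an automorphism f maps the clusters of \<eta>
  to those of \<open>act f \<eta>\<close>; the restriction to V keeps the result in the product
  space.\<close>

definition act :: "('v \<Rightarrow> 'v) \<Rightarrow> ('v \<Rightarrow> 'v set) \<Rightarrow> 'v \<Rightarrow> 'v set" where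
  "act f \<eta> = (\<lambda>y\<in>V. f ` \<eta> (inv_into V f y))"

context
  fixes f assumes f: "graph_automorphism V E f"
begin

lemma bij_f: "bij_betw f V V" and inj_f: "inj_on f V" and f_V: "x \<in> V \<Longrightarrow> f x \<in> V"
  using f by (auto simp: graph_automorphism_def bij_betw_def)

lemma f_E: "x \<in> V \<Longrightarrow> y \<in> V \<Longrightarrow> (f x, f y) \<in> E \<longleftrightarrow> (x, y) \<in> E"
  using f by (simp add: graph_automorphism_def)

lemma inv_V: "y \<in> V \<Longrightarrow> inv_into V f y \<in> V" and f_inv: "y \<in> V \<Longrightarrow> f (inv_into V f y) = y"
  and inv_f: "x \<in> V \<Longrightarrow> inv_into V f (f x) = x"
  using bij_f inj_f by (auto simp: bij_betw_def inv_into_into f_inv_into_f)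

lemma image_nbrs: "x \<in> V \<Longrightarrow> f ` (E `` {x}) = E `` {f x}"
proof (intro equalityI subsetI)
  fix y assume x: "x \<in> V" and y: "y \<in> E `` {f x}"
  then have yV: "y \<in> V" using nbrs_subset by auto
  then have "inv_into V f y \<in> E `` {x}"
    using y f_E[OF x inv_V[OF yV]] f_inv[OF yV] by simp
  then show "y \<in> f ` (E `` {x})" using f_inv[OF yV] by force
next
  fix y assume "x \<in> V" "y \<in> f ` (E `` {x})"
  then show "y \<in> E `` {f x}" using f_E nbrs_subset by auto
qed

lemma act_in_space: "\<eta> \<in> space P \<Longrightarrow> act f \<eta> \<in> space P"
proof -
  assume "\<eta> \<in> space P"
  then have "f ` \<eta> (inv_into V f y) \<subseteq> E `` {y}" if "y \<in> V" for y
    using image_nbrs[OF inv_V[OF that]] f_inv[OF that] inv_V[OF that] by (auto simp: space_P)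
  then show ?thesis by (auto simp: space_P act_def)
qed

lemma act_apply: "x \<in> V \<Longrightarrow> act f \<eta> (f x) = f ` \<eta> x"
  by (simp add: act_def f_V inv_f)

text \<open>The weight of a state depends only on its size, and f maps neighbourhoods bijectively
  onto neighbourhoods.\<close>

lemma emeasure_M_image:
  assumes x: "x \<in> V" and A: "A \<in> sets (M (f x))"
  shows "emeasure (M x) {S \<in> Pow (E `` {x}). f ` S \<in> A} = emeasure (M (f x)) A"
proof -
  let ?g = "\<lambda>S. ennreal (p (card S) / real (d choose card S))"
  have inj: "inj_on f (E `` {x})" using inj_f nbrs_subset by (rule inj_on_subset)
  have A': "A \<subseteq> Pow (E `` {f x})" using A by (simp add: sets_point_measure)
  have "emeasure (M x) {S \<in> Pow (E `` {x}). f ` S \<in> A} = sum ?g {S \<in> Pow (E `` {x}). f ` S \<in> A}"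
    using finite_nbrs[OF x] by (subst emeasure_point_measure_finite) auto
  also have "\<dots> = sum ?g A"
  proof (rule sum.reindex_cong[of "(`) f", symmetric])
    show "inj_on ((`) f) {S \<in> Pow (E `` {x}). f ` S \<in> A}"
      by (rule inj_on_subset[OF inj_on_image_Pow[OF inj]]) auto
    show "A = (`) f ` {S \<in> Pow (E `` {x}). f ` S \<in> A}"
    proof (intro equalityI subsetI)
      fix B assume B: "B \<in> A"
      then have "B \<subseteq> f ` (E `` {x})" using A' image_nbrs[OF x] by auto
      then obtain S where "S \<subseteq> E `` {x}" "B = f ` S" by (auto simp: subset_image_iff)
      with B show "B \<in> (`) f ` {S \<in> Pow (E `` {x}). f ` S \<in> A}" by auto
    qed auto
    fix S assume "S \<in> {S \<in> Pow (E `` {x}). f ` S \<in> A}"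
    then have "card (f ` S) = card S" using inj by (intro card_image) (auto intro: inj_on_subset)
    then show "?g (f ` S) = ?g S" by simp
  qed
  also have "\<dots> = emeasure (M (f x)) A"
    using finite_nbrs[OF f_V[OF x]] A' by (subst emeasure_point_measure_finite) auto
  finally show ?thesis .
qed

text \<open>After the action the coordinates in J depend only on the old ones in the preimage of J.
  So translates of cylinders are cylinders with a translated base.\<close>

lemma measurable_act_restrict:
  assumes J: "J \<subseteq> V"
  shows "(\<lambda>\<xi>. \<lambda>y\<in>J. f ` \<xi> (inv_into V f y)) \<in> measurable (Pi\<^sub>M (inv_into V f ` J) M) (Pi\<^sub>M J M)"
proof (rule measurable_restrict)
  fix y assume y: "y \<in> J"
  let ?x = "inv_into V f y"
  have x: "?x \<in> V" "f ?x = y" using y J inv_V f_inv by auto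
  have "(\<lambda>S. f ` S) \<in> measurable (M ?x) (M y)"
    using image_nbrs[OF x(1)] x(2) by (auto simp: space_point_measure)
  then show "(\<lambda>\<xi>. f ` \<xi> ?x) \<in> measurable (Pi\<^sub>M (inv_into V f ` J) M) (M y)"
    using y by (intro measurable_compose[OF measurable_component_singleton]) auto
qed

lemma inv_image_V: "inv_into V f ` V = V"
  using bij_betw_inv_into[OF bij_f] by (simp add: bij_betw_def)

lemma measurable_act: "act f \<in> measurable P P"
  using measurable_act_restrict[of V] unfolding act_def[abs_def] inv_image_V by simp

text \<open>The preimage of a box over J is a box over the preimage of J, with factors of equal
  mass.\<close>

lemma distr_act: "distr P P (act f) = P"
proof (rule measure_eqI_PiM_infinite[symmetric, OF refl])
  show "finite_measure P" by unfold_locales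
  fix A J assume J: "finite J" "J \<subseteq> V" and A: "\<And>i. i \<in> J \<Longrightarrow> A i \<in> sets (M i)"
  let ?g = "inv_into V f"
  let ?B = "\<lambda>x. {S \<in> Pow (E `` {x}). f ` S \<in> A (f x)}"
  have gJ: "?g ` J \<subseteq> V" using J inv_V by auto
  have emb: "prod_emb V M J (Pi\<^sub>E J A) \<in> sets P" using J A by (intro sets_PiM_I) auto
  have "act f -` prod_emb V M J (Pi\<^sub>E J A) \<inter> space P = prod_emb V M (?g ` J) (Pi\<^sub>E (?g ` J) ?B)"
  proof (intro equalityI subsetI)
    fix \<eta> assume "\<eta> \<in> act f -` prod_emb V M J (Pi\<^sub>E J A) \<inter> space P"
    then have \<eta>: "\<eta> \<in> space P" and *: "\<And>y. y \<in> J \<Longrightarrow> act f \<eta> y \<in> A y"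
      by (auto simp: prod_emb_def PiE_iff)
    have "\<eta> x \<in> ?B x" if x: "x \<in> ?g ` J" for x
    proof -
      from x obtain y where y: "y \<in> J" "x = ?g y" by auto
      then have "f x = y" "x \<in> V" using f_inv inv_V J by auto
      then show ?thesis using *[OF y(1)] act_apply[of x \<eta>] \<eta> by (auto simp: space_P)
    qed
    then show "\<eta> \<in> prod_emb V M (?g ` J) (Pi\<^sub>E (?g ` J) ?B)"
      using \<eta> by (auto simp: prod_emb_def space_PiM)
  next
    fix \<eta> assume "\<eta> \<in> prod_emb V M (?g ` J) (Pi\<^sub>E (?g ` J) ?B)"
    then have \<eta>: "\<eta> \<in> space P" and *: "\<And>x. x \<in> ?g ` J \<Longrightarrow> f ` \<eta> x \<in> A (f x)"
      by (auto simp: prod_emb_def space_PiM PiE_iff)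
    have "act f \<eta> y \<in> A y" if y: "y \<in> J" for y
      using *[of "?g y"] y f_inv[of y] J act_apply[OF inv_V, of y \<eta>] by auto
    then show "\<eta> \<in> act f -` prod_emb V M J (Pi\<^sub>E J A) \<inter> space P"
      using \<eta> act_in_space[OF \<eta>] by (auto simp: prod_emb_def space_PiM[symmetric])
  qed
  then have "emeasure (distr P P (act f)) (prod_emb V M J (Pi\<^sub>E J A)) =
      emeasure P (prod_emb V M (?g ` J) (Pi\<^sub>E (?g ` J) ?B))"
    by (simp add: emeasure_distr[OF measurable_act emb])
  also have "\<dots> = (\<Prod>x\<in>?g ` J. emeasure (M x) (?B x))"
    using gJ J by (intro emeasure_PiM_emb prob_space_M) (auto simp: sets_point_measure)
  also have "\<dots> = (\<Prod>y\<in>J. emeasure (M (?g y)) (?B (?g y)))"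
    by (rule prod.reindex_cong[of ?g])
      (use J inj_on_inv_into[of J f V] bij_f in \<open>auto simp: bij_betw_def\<close>)
  also have "\<dots> = (\<Prod>y\<in>J. emeasure (M y) (A y))"
  proof (rule prod.cong[OF refl])
    fix y assume y: "y \<in> J"
    then have x: "?g y \<in> V" "f (?g y) = y" using J f_inv inv_V by auto
    then show "emeasure (M (?g y)) (?B (?g y)) = emeasure (M y) (A y)"
      using emeasure_M_image[OF x(1), of "A y"] A[OF y] by simp
  qed
  also have "\<dots> = emeasure P (prod_emb V M J (Pi\<^sub>E J A))"
    using J A by (intro emeasure_PiM_emb[symmetric] prob_space_M) auto
  finally show "emeasure P (prod_emb V M J (Pi\<^sub>E J A)) =
    emeasure (distr P P (act f)) (prod_emb V M J (Pi\<^sub>E J A))" by simp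
qed simp

lemma prob_act:
  assumes "A \<in> sets P" shows "P.prob (act f -` A \<inter> space P) = P.prob A"
  using measure_distr[OF measurable_act assms] unfolding distr_act by simp

lemma num_infinite_clusters_act:
  assumes \<eta>: "\<eta> \<in> space P"
  shows "ecard (infinite_clusters V (links s V (act f \<eta>))) = ecard (infinite_clusters V (links s V \<eta>))"
proof (rule ecard_infinite_clusters_iso[OF bij_f links_subset_V links_subset_V])
  fix x y assume xy: "x \<in> V" "y \<in> V"
  have "f v \<in> f ` \<eta> u \<longleftrightarrow> v \<in> \<eta> u" if "u \<in> V" "v \<in> V" for u v
  proof -
    have "\<eta> u \<subseteq> V" using that \<eta> nbrs_subset[of u] unfolding space_P by blast
    then show ?thesis using inj_on_image_mem_iff[OF inj_f that(2)] by blast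
  qed
  then show "(f x, f y) \<in> links s V (act f \<eta>) \<longleftrightarrow> (x, y) \<in> links s V \<eta>"
    using xy f_V by (simp add: links_def act_apply)
qed

lemma relpow_automorphism:
  "x \<in> V \<Longrightarrow> (x, y) \<in> E ^^ n \<Longrightarrow> (f x, f y) \<in> E ^^ n"
proof (induction n arbitrary: y)
  case (Suc n)
  from Suc.prems(2) obtain z where z: "(x, z) \<in> E ^^ n" "(z, y) \<in> E" by auto
  have "(f z, f y) \<in> E" using z(2) f_E E_subset by blast
  with Suc.IH[OF Suc.prems(1) z(1)] show ?case by (rule relpow_Suc_I)
qed simp

end

lemma finite_relpow_sphere: "x \<in> V \<Longrightarrow> finite ((E ^^ n) `` {x})"
proof (induction n)
  case (Suc n)
  have "(E ^^ Suc n) `` {x} = (\<Union>z\<in>(E ^^ n) `` {x}. E `` {z})" by auto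
  moreover have "finite (E `` {z})" for z
  proof (cases "z \<in> V")
    case False
    then have "E `` {z} = {}" using E_subset by blast
    then show ?thesis by simp
  qed (rule finite_nbrs)
  ultimately show ?case using Suc by simp
qed simp

text \<open>Automorphisms preserve distances, so moving one vertex of \<open>J\<close> far away moves all of \<open>J\<close> away.\<close>

lemma automorphism_disjoint:
  assumes J: "finite J" "J \<subseteq> V"
  shows "\<exists>f. graph_automorphism V E f \<and> f ` J \<inter> J = {}"
proof -
  obtain r where r: "r \<in> V" using infinite_V infinite_imp_nonempty by blast
  have "\<exists>n. (r, x) \<in> E ^^ n" if "x \<in> J" for x
    using connected[OF r] J that by (auto simp: rtrancl_power)
  then obtain n where n: "\<And>x. x \<in> J \<Longrightarrow> (r, x) \<in> E ^^ n x" by metis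
  \<comment> \<open>If x and f x both lay in J, the walks from r to f x and from f x to the image of
    r would combine to length n (f x) + n x. \<open>D\<close> collects all endpoints of such
    walks.\<close>
  define D where "D = (\<Union>x\<in>J. \<Union>y\<in>J. (E ^^ (n x + n y)) `` {r})"
  have "finite D" using J finite_relpow_sphere[OF r] by (auto simp: D_def)
  then obtain o' where o': "o' \<in> V" "o' \<notin> D" using infinite_V by (meson ex_new_if_finite finite_subset subsetI)
  obtain f where f: "graph_automorphism V E f" "f r = o'" using transitive[OF r o'(1)] by blast
  have "f x \<notin> J" if x: "x \<in> J" for x
  proof
    assume fx: "f x \<in> J"
    have E: "(b, a) \<in> E ^^ m" if "(a, b) \<in> E ^^ m" for a b m
      using that
    proof (induction m arbitrary: b)
      case (Suc m)
      then obtain z where "(a, z) \<in> E ^^ m" "(z, b) \<in> E" by auto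
      then show ?case using Suc.IH symD[OF sym_E] by (blast intro: relpow_Suc_I2)
    qed simp
    have "(o', f x) \<in> E ^^ n x" using relpow_automorphism[OF f(1) r n[OF x]] f(2) by simp
    then have "(f x, o') \<in> E ^^ n x" by (rule E)
    then have "(r, o') \<in> E ^^ (n (f x) + n x)" using n[OF fx] by (auto simp: relpow_add)
    then show False using o' x fx by (auto simp: D_def)
  qed
  then show ?thesis using f by blast
qed

text \<open>Approximate A by a cylinder C and move C off its own base. By invariance the translate
  approximates A too, and by independence P(A) is close to P(C)^2, hence to P(A)^2.\<close>

lemma zero_one_law:
  assumes A: "A \<in> sets P"
    and inv: "\<And>f. graph_automorphism V E f \<Longrightarrow> act f -` A \<inter> space P = A"
  shows "P.prob A = 0 \<or> P.prob A = 1"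
proof -
  \<comment> \<open>Approximating A by both copies costs e / 2. Comparing the squares costs another
    e / 2, as two probabilities sum to at most 2. The form 0 + e fits
    \<open>field_le_epsilon\<close>.\<close>
  have small: "\<bar>P.prob A - P.prob A * P.prob A\<bar> \<le> 0 + e" if e: "0 < e" for e
  proof -
    obtain C where C: "C \<in> cylinders" "P.prob (sym_diff A C) < e / 4"
      using P.approx_by_algebra[OF algebra_cylinders sets_P_cylinders A, of "e / 4"] e by auto
    then obtain J B where J: "C = cylinder J B" "finite J" "J \<subseteq> V" "B \<in> sets (Pi\<^sub>M J M)"
      by (auto simp: cylinders_def)
    obtain f where f: "graph_automorphism V E f" "f ` J \<inter> J = {}"
      using automorphism_disjoint[OF J(2,3)] by blast
    let ?g = "inv_into V f" and ?T = "\<lambda>X. act f -` X \<inter> space P"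
    have CP: "C \<in> sets P" using J sets_cylinder by simp
    have TP: "?T X \<in> sets P" if "X \<in> sets P" for X
      using measurable_sets[OF measurable_act[OF f(1)] that] .
    have gJ: "?g ` J \<subseteq> V" using inv_V[OF f(1)] J by auto
    have dis: "J \<inter> ?g ` J = {}"
    proof -
      have False if "y \<in> J" "?g y \<in> J" for y
        using that f(2) f_inv[OF f(1), of y] J(3) by (metis disjoint_iff image_eqI subsetD)
      then show ?thesis by blast
    qed
    let ?h = "\<lambda>\<xi>. \<lambda>y\<in>J. f ` \<xi> (?g y)"
    let ?B = "?h -` B \<inter> space (Pi\<^sub>M (?g ` J) M)"
    have B': "?B \<in> sets (Pi\<^sub>M (?g ` J) M)"
      using measurable_sets[OF measurable_act_restrict[OF f(1) J(3)] J(4)] .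
    have TC: "?T C = cylinder (?g ` J) ?B"
    proof -
      have "restrict (act f \<eta>) J = ?h (restrict \<eta> (?g ` J))" for \<eta>
        using J(3) by (auto simp: act_def fun_eq_iff)
      moreover have "restrict \<eta> (?g ` J) \<in> space (Pi\<^sub>M (?g ` J) M)" if "\<eta> \<in> space P" for \<eta>
        using measurable_space[OF measurable_restrict_P[OF gJ] that] .
      ultimately show ?thesis
        using act_in_space[OF f(1)] by (auto simp: J(1) cylinder_def)
    qed
    have indep: "P.prob (C \<inter> ?T C) = P.prob C * P.prob C"
      using indep_cylinders[OF J(3) gJ dis J(4) B'] prob_act[OF f(1) CP] unfolding TC[symmetric] J(1)[symmetric]
      by simp
    have TA: "?T A = A" by (rule inv[OF f(1)])
    have m: "sym_diff A C \<in> sets P" "sym_diff (?T A) (?T C) \<in> sets P" "C \<inter> ?T C \<in> sets P"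
      using A CP TP[OF A] TP[OF CP] by blast+
    have T_diff: "?T (sym_diff A C) = sym_diff (?T A) (?T C)" by blast
    have d: "P.prob (sym_diff (?T A) (?T C)) = P.prob (sym_diff A C)"
      by (rule prob_act[OF f(1) m(1), unfolded T_diff])
    have "\<bar>P.prob A - P.prob (C \<inter> ?T C)\<bar> \<le> P.prob (sym_diff A (C \<inter> ?T C))"
      by (rule P.abs_prob_diff_le[OF A m(3)])
    also have "\<dots> \<le> P.prob (sym_diff A C \<union> sym_diff (?T A) (?T C))"
    proof (rule P.finite_measure_mono)
      show "sym_diff A (C \<inter> ?T C) \<subseteq> sym_diff A C \<union> sym_diff (?T A) (?T C)" unfolding TA by blast
    qed (use m in blast)
    also have "\<dots> \<le> P.prob (sym_diff A C) + P.prob (sym_diff (?T A) (?T C))"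
      by (rule measure_Un_le[OF m(1,2)])
    finally have "\<bar>P.prob A - P.prob C * P.prob C\<bar> \<le> P.prob (sym_diff A C) + P.prob (sym_diff A C)"
      unfolding d indep .
    also have "\<dots> \<le> e / 4 + e / 4" using C(2) by (intro add_mono) simp_all
    finally have 1: "\<bar>P.prob A - P.prob C * P.prob C\<bar> \<le> e / 2" by simp
    have AC: "\<bar>P.prob C - P.prob A\<bar> \<le> e / 4"
      using order_trans[OF P.abs_prob_diff_le[OF A CP] less_imp_le[OF C(2)]]
      unfolding abs_minus_commute[of "P.prob A"] .
    have "P.prob C * P.prob C - P.prob A * P.prob A = (P.prob C + P.prob A) * (P.prob C - P.prob A)"
      by (simp add: algebra_simps)
    then have "\<bar>P.prob C * P.prob C - P.prob A * P.prob A\<bar> = \<bar>P.prob C + P.prob A\<bar> * \<bar>P.prob C - P.prob A\<bar>"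
      by (simp only: abs_mult)
    also have "\<dots> \<le> (1 + 1) * (e / 4)"
    proof (rule mult_mono[OF _ AC])
      have "P.prob C + P.prob A \<le> 1 + 1" by (intro add_mono P.prob_le_1)
      then show "\<bar>P.prob C + P.prob A\<bar> \<le> 1 + 1" using measure_nonneg[of P C] measure_nonneg[of P A] by (simp only: abs_of_nonneg add_nonneg_nonneg)
    qed simp_all
    also have "(1 + 1) * (e / 4) = e / 2" by simp
    finally have 2: "\<bar>P.prob C * P.prob C - P.prob A * P.prob A\<bar> \<le> e / 2" .
    have tri: "\<bar>a - c\<bar> \<le> \<bar>a - b\<bar> + \<bar>b - c\<bar>" for a b c :: real by linarith
    have "\<bar>P.prob A - P.prob A * P.prob A\<bar> \<le> e / 2 + e / 2"
      by (rule order_trans[OF tri add_mono[OF 1 2]])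
    also have "e / 2 + e / 2 = 0 + e" by simp
    finally show ?thesis .
  qed
  have "\<bar>P.prob A - P.prob A * P.prob A\<bar> \<le> 0" by (rule field_le_epsilon[OF small])
  then have "P.prob A - P.prob A * P.prob A = 0" by (simp only: abs_le_zero_iff)
  then have "P.prob A * (1 - P.prob A) = 0" by (simp only: right_diff_distrib mult_1_right)
  then have "P.prob A = 0 \<or> 1 - P.prob A = 0" by (rule mult_eq_0_iff[THEN iffD1])
  then show ?thesis by linarith
qed

lemma prob_num_infinite_clusters:
  "P.prob {\<eta> \<in> space P. ecard (infinite_clusters V (links s V \<eta>)) = c} \<in> {0, 1}"
proof -
  let ?A = "{\<eta> \<in> space P. ecard (infinite_clusters V (links s V \<eta>)) = c}"
  have "act f -` ?A \<inter> space P = ?A" if "graph_automorphism V E f" for f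
    using act_in_space[OF that] num_infinite_clusters_act[OF that] by auto
  from zero_one_law[OF sets_num_infinite_clusters this] show ?thesis by simp
qed

text \<open>There are only countably many values in \<open>enat\<close>; if none had probability
  one, all would be avoided simultaneously.\<close>

lemma AE_num_infinite_clusters:
  obtains c where "AE \<eta> in P. ecard (infinite_clusters V (links s V \<eta>)) = c"
proof (rule ccontr)
  assume none: "\<not> thesis"
  have "AE \<eta> in P. ecard (infinite_clusters V (links s V \<eta>)) \<noteq> c" for c
  proof -
    let ?A = "{\<eta> \<in> space P. ecard (infinite_clusters V (links s V \<eta>)) = c}"
    have "P.prob ?A \<noteq> 1"
      using none that[of c] P.AE_prob_1[of ?A] by (auto elim: AE_mp)
    then have "P.prob ?A = 0" using prob_num_infinite_clusters[of s c] by auto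
    then show ?thesis
      using P.prob_Collect_eq_0[OF sets_num_infinite_clusters] by blast
  qed
  then have "AE \<eta> in P. \<forall>c. ecard (infinite_clusters V (links s V \<eta>)) \<noteq> c"
    unfolding AE_all_countable by blast
  then have "AE \<eta> in P. False" by simp
  then show False using P.AE_contr[of "\<lambda>_. False"] by simp
qed

end

section \<open>Forward orbits are finite when out-degrees are at most one\<close>

text \<open>
  Walks are listed backwards: the head is the current endpoint and the last element is the
  starting point.
\<close>

fun follows :: "('v \<Rightarrow> 'v set) \<Rightarrow> 'v list \<Rightarrow> bool" where
  "follows \<eta> (y # u # zs) \<longleftrightarrow> \<eta> u = {y} \<and> follows \<eta> (u # zs)"
| "follows \<eta> _ \<longleftrightarrow> True"

fun successor :: "'v list \<Rightarrow> 'v \<Rightarrow> 'v" where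
  "successor (y # u # zs) = (successor (u # zs))(u := y)"
| "successor _ = (\<lambda>_. undefined)"

text \<open>A self-avoiding walk puts one condition on each vertex except its endpoint, so following
  it is a product event.\<close>

lemma follows_successor:
  "distinct xs \<Longrightarrow> follows \<eta> xs \<longleftrightarrow> (\<forall>v\<in>set (tl xs). \<eta> v = {successor xs v})"
proof (induction \<eta> xs rule: follows.induct)
  case (1 \<eta> y u zs)
  then have "follows \<eta> (u # zs) \<longleftrightarrow> (\<forall>v\<in>set zs. \<eta> v = {successor (u # zs) v})" by simp
  moreover have "u \<notin> set zs" using 1 by simp
  ultimately show ?case by auto
qed simp_all

lemma follows_closed: "follows \<eta> xs \<Longrightarrow> v \<in> set (tl xs) \<Longrightarrow> \<eta> v \<subseteq> set xs"
  by (induction \<eta> xs rule: follows.induct) auto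

context random_digraph
begin

fun walks :: "'v \<Rightarrow> nat \<Rightarrow> 'v list set" where
  "walks x 0 = {[x]}"
| "walks x (Suc n) = (\<Union>xs\<in>walks x n. (\<lambda>y. y # xs) ` (E `` {hd xs} - set xs))"

lemma walks_simps:
  assumes "x \<in> V" "xs \<in> walks x n"
  shows "length xs = Suc n \<and> distinct xs \<and> set xs \<subseteq> V \<and> x \<in> set xs \<and>
    (\<forall>v\<in>set (tl xs). successor xs v \<in> E `` {v})"
  using assms(2)
proof (induction n arbitrary: xs)
  case (Suc n)
  then obtain y ys where ys: "xs = y # ys" "ys \<in> walks x n" "y \<in> E `` {hd ys} - set ys" by auto
  note IH = Suc.IH[OF ys(2)]
  then obtain u zs where u: "ys = u # zs" by (cases ys) auto
  show ?case using ys IH nbrs_subset[of u] unfolding u by auto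
qed (use assms in simp)

text \<open>The first step has at most d choices and each later one at most d - 1, since the
  previous vertex is a neighbour already used.\<close>

lemma walks_card:
  assumes x: "x \<in> V"
  shows "finite (walks x n) \<and> card (walks x (Suc n)) \<le> d * (d - 1) ^ n"
proof (induction n)
  case 0
  have "walks x (Suc 0) = (\<lambda>y. [y, x]) ` (E `` {x} - {x})" by auto
  moreover have "card (E `` {x} - {x}) \<le> d"
    using card_mono[OF finite_nbrs[OF x], of "E `` {x} - {x}"] regular[OF x] by auto
  ultimately show ?case
    using card_image_le[of "E `` {x} - {x}" "\<lambda>y. [y, x]"] finite_nbrs[OF x] by simp
next
  case (Suc n)
  let ?N = "\<lambda>xs. (\<lambda>y. y # xs) ` (E `` {hd xs} - set xs)"
  have hdV: "hd xs \<in> V" if "xs \<in> walks x m" for xs m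
    using walks_simps[OF x that] by (cases xs) auto
  have fin: "finite (walks x (Suc n))"
    using Suc hdV finite_nbrs by (auto intro!: finite_UN_I)
  have N: "card (?N xs) \<le> d - 1" if xs: "xs \<in> walks x (Suc n)" for xs
  proof -
    obtain y ys where ys: "xs = y # ys" "ys \<in> walks x n" "y \<in> E `` {hd ys} - set ys" using xs by auto
    then obtain u zs where u: "ys = u # zs" using walks_simps[OF x ys(2)] by (cases ys) auto
    have yV: "y \<in> V" using hdV[OF xs] ys by simp
    have uE: "u \<in> E `` {y}" using ys u symD[OF sym_E] by auto
    have "card (?N xs) \<le> card (E `` {y} - set xs)"
      using ys finite_nbrs[OF yV] by (intro card_image_le[THEN order_trans]) auto
    also have "\<dots> \<le> card (E `` {y} - {u})"
      using finite_nbrs[OF yV] ys u by (intro card_mono) auto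
    also have "\<dots> = d - 1" using uE regular[OF yV] by simp
    finally show ?thesis .
  qed
  have "card (walks x (Suc (Suc n))) \<le> (\<Sum>xs\<in>walks x (Suc n). card (?N xs))"
    unfolding walks.simps(2)[of x "Suc n"] by (rule card_UN_le[OF fin])
  also have "\<dots> \<le> (\<Sum>xs\<in>walks x (Suc n). d - 1)" by (rule sum_mono[OF N])
  also have "\<dots> = card (walks x (Suc n)) * (d - 1)" by simp
  also have "\<dots> \<le> d * (d - 1) ^ n * (d - 1)" using Suc by (intro mult_right_mono) auto
  finally show ?case using fin by (simp add: mult_ac)
qed

text \<open>Each of the n vertices that the walk leaves contributes the weight of one singleton, p 1
  divided by \<open>d choose 1\<close>.\<close>

lemma prob_follows:
  assumes x: "x \<in> V" and xs: "xs \<in> walks x n"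
  shows "{\<eta> \<in> space P. follows \<eta> xs} \<in> sets P"
    and "P.prob {\<eta> \<in> space P. follows \<eta> xs} = (p 1 / real d) ^ n"
proof -
  note w = walks_simps[OF x xs]
  let ?J = "set (tl xs)" and ?X = "\<lambda>v. {{successor xs v}}"
  have J: "?J \<subseteq> V" using w by (cases xs) auto
  have eq: "{\<eta> \<in> space P. follows \<eta> xs} = prod_emb V M ?J (Pi\<^sub>E ?J ?X)"
  proof -
    have "follows \<eta> xs \<longleftrightarrow> (\<forall>v\<in>?J. \<eta> v = {successor xs v})" for \<eta> using w follows_successor by metis
    then show ?thesis by (auto simp: prod_emb_def space_PiM Pi_iff)
  qed
  have X: "?X v \<in> sets (M v)" if "v \<in> ?J" for v
    using w that by (auto simp: sets_point_measure)
  show "{\<eta> \<in> space P. follows \<eta> xs} \<in> sets P"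
    unfolding eq using J X by (intro sets_PiM_I) auto
  have d: "emeasure (M v) (?X v) = ennreal (p 1 / real d)" if "v \<in> ?J" for v
    using w that J finite_nbrs[of v] by (subst emeasure_point_measure_finite) auto
  have "0 \<le> p 1 / real d"
  proof (cases "d = 0")
    case False
    then show ?thesis using p by (simp add: degree_distribution_def)
  qed simp
  then have "emeasure P {\<eta> \<in> space P. follows \<eta> xs} = ennreal ((p 1 / real d) ^ card ?J)"
    unfolding eq using J X d by (subst emeasure_PiM_emb) (auto simp: prob_space_M ennreal_power)
  moreover have "card ?J = n" using w distinct_card[of "tl xs"] by (cases xs) auto
  ultimately show "P.prob {\<eta> \<in> space P. follows \<eta> xs} = (p 1 / real d) ^ n"
    using \<open>0 \<le> p 1 / real d\<close> by (simp add: Sigma_Algebra.measure_def)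
qed

text \<open>If the state of the endpoint pointed back into the walk or were empty, the walk would be
  closed under open edges and the orbit finite. So the walk can always be prolonged.\<close>

lemma infinite_orbit_follows:
  assumes \<eta>: "\<eta> \<in> space P" and out: "\<And>v. v \<in> V \<Longrightarrow> card (\<eta> v) \<le> 1"
    and x: "x \<in> V" and inf: "infinite ((open_edges V \<eta>)\<^sup>* `` {x})"
  shows "\<exists>xs\<in>walks x n. follows \<eta> xs"
proof (induction n)
  case (Suc n)
  then obtain xs where xs: "xs \<in> walks x n" "follows \<eta> xs" by blast
  note w = walks_simps[OF x xs(1)]
  then obtain u zs where u: "xs = u # zs" by (cases xs) auto
  have uV: "u \<in> V" using w u by simp
  have "\<not> \<eta> u \<subseteq> set xs"
  proof
    assume sub: "\<eta> u \<subseteq> set xs"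
    have closed: "\<eta> v \<subseteq> set xs" if "v \<in> set xs" for v
      using that sub follows_closed[OF xs(2)] u by auto
    have "v \<in> set xs" if "(x, v) \<in> (open_edges V \<eta>)\<^sup>*" for v
      using that
    proof (induction rule: rtrancl_induct)
      case (step a b)
      then show ?case using closed[of a] by (auto simp: open_edges_def)
    qed (use w in simp)
    then have "(open_edges V \<eta>)\<^sup>* `` {x} \<subseteq> set xs" by auto
    then show False using inf finite_subset by blast
  qed
  then obtain y where y: "y \<in> \<eta> u" "y \<notin> set xs" by blast
  have sub: "\<eta> u \<subseteq> E `` {u}" using \<eta> uV by (simp add: space_P)
  then have "finite (\<eta> u)" using finite_nbrs[OF uV] finite_subset by blast
  then have "\<eta> u = {y}" using out[OF uV] y(1) by (auto simp: card_le_Suc0_iff_eq)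
  then have "follows \<eta> (y # xs)" using xs(2) u by simp
  moreover have "y \<in> E `` {hd xs} - set xs" using y sub u by auto
  then have "y # xs \<in> walks x (Suc n)" using xs(1) unfolding walks.simps by blast
  ultimately show ?case by blast
qed simp

lemma AE_finite_orbits:
  assumes out: "\<And>i. 2 \<le> i \<Longrightarrow> i \<le> d \<Longrightarrow> p i = 0"
  shows "AE \<eta> in P. \<forall>x\<in>V. finite ((open_edges V \<eta>)\<^sup>* `` {x})"
proof (rule AE_ball_countable[THEN iffD2, OF countable_V], rule ballI)
  fix x assume x: "x \<in> V"
  let ?S = "\<lambda>n. \<Union>xs\<in>walks x n. {\<eta> \<in> space P. follows \<eta> xs}"
  have S: "?S n \<in> sets P" for n
    using walks_card[OF x] prob_follows(1)[OF x] by (intro sets.finite_UN) auto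
  \<comment> \<open>With n + 1 steps, the factor d from the choice of the first step cancels against
    one of the factors 1 / d.\<close>
  have le: "P.prob (?S (Suc n)) \<le> ((real d - 1) / real d) ^ n" if d: "1 \<le> d" for n
  proof -
    have "P.prob (?S (Suc n)) \<le> (\<Sum>xs\<in>walks x (Suc n). P.prob {\<eta> \<in> space P. follows \<eta> xs})"
      using walks_card[OF x] prob_follows(1)[OF x]
      by (intro P.finite_measure_subadditive_finite) (blast, blast)
    also have "\<dots> = real (card (walks x (Suc n))) * (p 1 / real d) ^ Suc n"
      using prob_follows(2)[OF x, of _ "Suc n"] by simp
    also have "\<dots> \<le> real (d * (d - 1) ^ n) * (1 / real d) ^ Suc n"
    proof (intro mult_mono power_mono divide_right_mono)
      show "real (card (walks x (Suc n))) \<le> real (d * (d - 1) ^ n)"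
        using walks_card[OF x] by (simp only: of_nat_le_iff)
      have "p 1 \<le> (\<Sum>i\<le>d. p i)"
        using p d by (intro member_le_sum) (auto simp: degree_distribution_def)
      then show "p 1 \<le> 1" using p by (simp add: degree_distribution_def)
      show "0 \<le> p 1 / real d" "0 \<le> (p 1 / real d) ^ Suc n"
        using p d by (auto simp: degree_distribution_def)
    qed simp_all
    also have "\<dots> = ((real d - 1) / real d) ^ n"
      using d by (simp add: power_divide of_nat_diff)
    finally show ?thesis .
  qed
  have "d \<noteq> 0"
  proof
    assume "d = 0"
    then have "E `` {v} = {}" if "v \<in> V" for v using regular[OF that] finite_nbrs[OF that] by simp
    then have "E = {}" using E_subset by blast
    then have "V \<subseteq> {x}" using connected[OF x] by auto
    then show False using infinite_V finite_subset by blast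
  qed
  then have d: "1 \<le> d" by simp
  have "(\<lambda>n. ((real d - 1) / real d) ^ n) \<longlonglongrightarrow> 0"
    using d by (intro LIMSEQ_power_zero) simp
  define N where "N = (\<Inter>n. ?S n)"
  have N: "N \<in> sets P" unfolding N_def using S by blast
  have "P.prob N \<le> ((real d - 1) / real d) ^ n" for n
  proof -
    have "P.prob N \<le> P.prob (?S (Suc n))"
      by (rule P.finite_measure_mono[OF _ S]) (unfold N_def, blast)
    also have "\<dots> \<le> ((real d - 1) / real d) ^ n" by (rule le[OF d])
    finally show ?thesis .
  qed
  then have "P.prob N \<le> 0"
    using \<open>(\<lambda>n. ((real d - 1) / real d) ^ n) \<longlonglongrightarrow> 0\<close> by (intro LIMSEQ_le_const) auto
  then have "P.prob N = 0" using measure_nonneg[of P N] by simp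
  then have "AE \<eta> in P. \<eta> \<notin> N" using N by (simp add: P.prob_eq_0)
  with AE_state_pos AE_space show "AE \<eta> in P. finite ((open_edges V \<eta>)\<^sup>* `` {x})"
  proof eventually_elim
    case (elim \<eta>)
    show ?case
    proof (rule ccontr)
      assume "infinite ((open_edges V \<eta>)\<^sup>* `` {x})"
      moreover have "card (\<eta> v) \<le> 1" if v: "v \<in> V" for v
      proof (rule ccontr)
        assume "\<not> card (\<eta> v) \<le> 1"
        moreover have "card (\<eta> v) \<le> d" using elim v card_state_le unfolding space_P by blast
        ultimately have "p (card (\<eta> v)) = 0" using out[of "card (\<eta> v)"] by simp
        then show False using elim v by auto
      qed
      ultimately have "\<exists>xs\<in>walks x n. follows \<eta> xs" for n
        using infinite_orbit_follows[OF _ _ x] elim by blast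
      then have "\<eta> \<in> N" using elim by (auto simp: N_def)
      then show False using elim by blast
    qed
  qed
qed

end

section \<open>Excluding finitely many, but more than one, infinite clusters\<close>

lemma (in closed_configs) two_clusters_separated:
  assumes "\<eta> \<in> T" "2 \<le> k"
  obtains x y where "separated \<eta> x y"
proof -
  have "\<not> card (infinite_clusters V (L \<eta>)) \<le> Suc 0" using assms card_k by simp
  then obtain C D where CD: "C \<in> infinite_clusters V (L \<eta>)" "D \<in> infinite_clusters V (L \<eta>)" "C \<noteq> D"
    using card_le_Suc0_iff_eq[OF fin[OF assms(1)]] by blast
  then obtain x y where "x \<in> V" "y \<in> V" "C = (L \<eta>)\<^sup>* `` {x}" "D = (L \<eta>)\<^sup>* `` {y}" "infinite C" "infinite D"
    unfolding infinite_clusters_iff by metis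
  with CD(3) assms(1) have "separated \<eta> x y"
    using cluster_eq_iff[OF sym_links, of s V \<eta> x y] by (simp add: separated_def)
  then show thesis by (rule that)
qed

context random_digraph
begin

lemma links_conn:
  assumes "\<eta> \<in> space P"
  shows "weak_conn V \<eta> = (links False V \<eta>)\<^sup>*" "strong_conn V \<eta> = (links True V \<eta>)\<^sup>*"
proof -
  have sub: "y \<in> V" if "x \<in> V" "y \<in> \<eta> x" for x y
    using assms that nbrs_subset unfolding space_P by blast
  have "open_edges V \<eta> \<union> (open_edges V \<eta>)\<inverse> = links False V \<eta>"
    "open_edges V \<eta> \<inter> (open_edges V \<eta>)\<inverse> = links True V \<eta>"
    using sub by (auto simp: open_edges_def links_def)
  then show "weak_conn V \<eta> = (links False V \<eta>)\<^sup>*" "strong_conn V \<eta> = (links True V \<eta>)\<^sup>*"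
    by (simp_all add: weak_conn_def strong_conn_def)
qed

lemma AE_card_le_1:
  assumes "\<And>i. 2 \<le> i \<Longrightarrow> i \<le> d \<Longrightarrow> p i = 0"
  shows "AE \<eta> in P. \<forall>x\<in>V. card (\<eta> x) \<le> 1"
  using AE_state_pos AE_space
proof eventually_elim
  case (elim \<eta>)
  show ?case
  proof
    fix x assume x: "x \<in> V"
    then have "card (\<eta> x) \<le> d" using elim card_state_le unfolding space_P by blast
    moreover have "p (card (\<eta> x)) \<noteq> 0" using elim x by auto
    ultimately show "card (\<eta> x) \<le> 1" using assms[of "card (\<eta> x)"] by (cases "2 \<le> card (\<eta> x)") auto
  qed
qed

text \<open>A strong link needs arrows both ways, so out-degree at most one allows a single partner.
  In the weak case without singletons all states are empty.\<close>

lemma finite_cluster_degenerate: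
  assumes \<eta>: "\<eta> \<in> space P" and card: "\<And>x. x \<in> V \<Longrightarrow> card (\<eta> x) \<le> 1 \<and> 0 < p (card (\<eta> x))"
    and deg: "s \<or> \<not> 0 < p 1" and r: "r \<in> V"
  shows "finite ((links s V \<eta>)\<^sup>* `` {r})"
proof (rule finite_subset)
  have fin: "finite (\<eta> x)" if "x \<in> V" for x
    using \<eta> that finite_nbrs[OF that] finite_subset unfolding space_P by blast
  show "finite (insert r (\<eta> r))" using fin[OF r] by simp
  have uniq: "a = b" if "x \<in> V" "a \<in> \<eta> x" "b \<in> \<eta> x" for x a b
    using card[OF that(1)] fin[OF that(1)] that by (auto simp: card_le_Suc0_iff_eq)
  have empty: "\<eta> x = {}" if "\<not> s" "x \<in> V" for x
  proof -
    have "card (\<eta> x) \<noteq> 1" using card[OF that(2)] deg that(1) by auto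
    then show ?thesis using card[OF that(2)] fin[OF that(2)] by (simp add: le_Suc_eq)
  qed
  show "(links s V \<eta>)\<^sup>* `` {r} \<subseteq> insert r (\<eta> r)"
  proof
    fix z assume "z \<in> (links s V \<eta>)\<^sup>* `` {r}"
    then have "(r, z) \<in> (links s V \<eta>)\<^sup>*" by simp
    then have "z = r \<or> z \<in> \<eta> r \<and> r \<in> \<eta> z"
    proof (induction rule: rtrancl_induct)
      case (step a b)
      then have V: "a \<in> V" "b \<in> V" and ab: "if s then b \<in> \<eta> a \<and> a \<in> \<eta> b else b \<in> \<eta> a \<or> a \<in> \<eta> b"
        by (auto simp: links_def)
      with empty have ab: "b \<in> \<eta> a" "a \<in> \<eta> b" by (auto split: if_splits)
      with step.IH uniq[OF V(1), of b r] show ?case by blast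
    qed simp
    then show "z \<in> insert r (\<eta> r)" by blast
  qed
qed

text \<open>The value 0 contradicts the hypothesis on r. A finite value of at least 2 yields a
  separated pair in \<open>T\<close>, which one of the two surgeries refutes unless clusters are
  trivially finite.\<close>

lemma num_infinite_clusters_one_or_infinite:
  assumes r: "r \<in> V" and inf: "\<not> (AE \<eta> in P. finite ((links s V \<eta>)\<^sup>* `` {r}))"
  shows "(AE \<eta> in P. ecard (infinite_clusters V (links s V \<eta>)) = 1) \<or>
         (AE \<eta> in P. ecard (infinite_clusters V (links s V \<eta>)) = \<infinity>)"
proof -
  obtain c where c: "AE \<eta> in P. ecard (infinite_clusters V (links s V \<eta>)) = c"
    by (rule AE_num_infinite_clusters)
  have ecard: "finite K \<and> card K = k" if "ecard K = enat k" for K :: "'v set set" and k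
    using that by (simp add: ecard_def split: if_splits)
  show ?thesis
  proof (cases c)
    case infinity
    with c show ?thesis by simp
  next
    case (enat k)
    have "k \<noteq> 0"
    proof
      assume "k = 0"
      have "AE \<eta> in P. finite ((links s V \<eta>)\<^sup>* `` {r})"
        using c
      proof eventually_elim
        case (elim \<eta>)
        then have "finite (infinite_clusters V (links s V \<eta>)) \<and> card (infinite_clusters V (links s V \<eta>)) = 0"
          using enat \<open>k = 0\<close> by (intro ecard) simp
        then have "infinite_clusters V (links s V \<eta>) = {}" using card_0_eq by blast
        then show ?case using cluster_in_infinite_clusters[OF r] by blast
      qed
      then show False using inf by blast
    qed
    moreover have "\<not> 2 \<le> k"
    proof
      assume k: "2 \<le> k"
      have closed_configs: "closed_configs V E d p s k T"
        if T: "T \<subseteq> space P"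
          "\<And>\<eta>. \<eta> \<in> T \<Longrightarrow> ecard (infinite_clusters V (links s V \<eta>)) = enat k \<and> (\<forall>x\<in>V. 0 < p (card (\<eta> x)))"
          "\<And>\<eta> x S. \<eta> \<in> T \<Longrightarrow> x \<in> V \<Longrightarrow> S \<subseteq> E `` {x} \<Longrightarrow> 0 < p (card S) \<Longrightarrow> \<eta>(x := S) \<in> T" for T
      proof unfold_locales
        fix \<eta> x assume "\<eta> \<in> T" "x \<in> V"
        then have "\<eta> \<in> space P" using T(1) by blast
        then show "\<eta> x \<subseteq> E `` {x}" using \<open>x \<in> V\<close> unfolding space_P by blast
      qed (use T(2,3) ecard in blast)+
      show False
      proof (cases "\<exists>i. 2 \<le> i \<and> i \<le> d \<and> 0 < p i")
        case True
        then obtain i where i: "2 \<le> i" "i \<le> d" "0 < p i" by blast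
        define Q where "Q \<eta> \<longleftrightarrow> ecard (infinite_clusters V (links s V \<eta>)) = enat k" for \<eta>
        have "AE \<eta> in P. Q \<eta>" unfolding Q_def using c[unfolded enat] .
        then obtain T where T: "T \<noteq> {}" "T \<subseteq> space P"
          "\<forall>\<eta>\<in>T. Q \<eta> \<and> (\<forall>x\<in>V. 0 < p (card (\<eta> x)))"
          "\<forall>\<eta>\<in>T. \<forall>x\<in>V. \<forall>S. S \<subseteq> E `` {x} \<longrightarrow> 0 < p (card S) \<longrightarrow> \<eta>(x := S) \<in> T"
          by (elim closed_set_exists[THEN exE] conjE)
        interpret C: closed_configs V E d p s k T
          by (rule closed_configs[OF T(2) _ T(4)[rule_format]]) (use T(3) in \<open>auto simp: Q_def\<close>)
        interpret C: closed_configs_two V E d p s k T i by unfold_locales (use i in auto)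
        obtain \<eta> where "\<eta> \<in> T" using T(1) by blast
        then show False using C.two_clusters_separated[OF _ k] C.no_separated by blast
      next
        case False
        have p0: "p i = 0" if "2 \<le> i" "i \<le> d" for i
        proof (rule antisym)
          show "p i \<le> 0" using False that by (simp add: not_less)
          show "0 \<le> p i" using p that by (simp add: degree_distribution_def)
        qed
        have le_1: "AE \<eta> in P. \<forall>x\<in>V. card (\<eta> x) \<le> 1" by (rule AE_card_le_1) (rule p0)
        have orbits: "AE \<eta> in P. \<forall>x\<in>V. finite ((open_edges V \<eta>)\<^sup>* `` {x})"
          by (rule AE_finite_orbits) (rule p0)
        show False
        proof (cases "s \<or> \<not> 0 < p 1")
          case True
          have "AE \<eta> in P. finite ((links s V \<eta>)\<^sup>* `` {r})"
            using le_1 AE_state_pos AE_space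
          proof eventually_elim
            case (elim \<eta>)
            then show ?case by (intro finite_cluster_degenerate[OF _ _ True r]) auto
          qed
          then show False using inf by blast
        next
          case False
          define Q where "Q \<eta> \<longleftrightarrow> ecard (infinite_clusters V (links s V \<eta>)) = enat k \<and>
            (\<forall>x\<in>V. card (\<eta> x) \<le> 1) \<and> (\<forall>x\<in>V. finite ((open_edges V \<eta>)\<^sup>* `` {x}))" for \<eta>
          have "AE \<eta> in P. Q \<eta>"
            unfolding Q_def using c[unfolded enat] le_1 orbits by eventually_elim blast
          then obtain T where T: "T \<noteq> {}" "T \<subseteq> space P"
            "\<forall>\<eta>\<in>T. Q \<eta> \<and> (\<forall>x\<in>V. 0 < p (card (\<eta> x)))"
            "\<forall>\<eta>\<in>T. \<forall>x\<in>V. \<forall>S. S \<subseteq> E `` {x} \<longrightarrow> 0 < p (card S) \<longrightarrow> \<eta>(x := S) \<in> T"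
            by (elim closed_set_exists[THEN exE] conjE)
          interpret C: closed_configs V E d p s k T
            by (rule closed_configs[OF T(2) _ T(4)[rule_format]]) (use T(3) in \<open>auto simp: Q_def\<close>)
          interpret C: closed_configs_functional V E d p s k T
            by unfold_locales (use False T(3) in \<open>auto simp: Q_def\<close>)
          obtain \<eta> where "\<eta> \<in> T" using T(1) by blast
          then show False using C.two_clusters_separated[OF _ k] C.no_separated_functional by blast
        qed
      qed
    qed
    ultimately have "c = 1" using enat by (simp add: one_enat_def)
    with c show ?thesis by simp
  qed
qed

text \<open>\<open>conn\<close> stands for either notion of connection; the agreement with
  \<open>links\<close> is asked only on \<open>space P\<close>, where states stay inside V.\<close>

lemma prob_num_infinite_clusters_one_or_infinite:
  assumes r: "r \<in> V" and conn: "\<And>\<eta>. \<eta> \<in> space P \<Longrightarrow> conn \<eta> = (links s V \<eta>)\<^sup>*"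
    and pos: "0 < \<P>(\<eta> in P. infinite (conn \<eta> `` {r}))"
  shows "\<P>(\<eta> in P. ecard {C \<in> V // conn \<eta>. infinite C} = 1) = 1 \<or>
         \<P>(\<eta> in P. ecard {C \<in> V // conn \<eta>. infinite C} = \<infinity>) = 1"
proof -
  have "{\<eta> \<in> space P. infinite (conn \<eta> `` {r})} = {\<eta> \<in> space P. infinite ((links s V \<eta>)\<^sup>* `` {r})}"
    using conn by auto
  then have "P.prob {\<eta> \<in> space P. infinite ((links s V \<eta>)\<^sup>* `` {r})} \<noteq> 0" using pos by simp
  then have "\<not> (AE \<eta> in P. finite ((links s V \<eta>)\<^sup>* `` {r}))"
    using P.prob_Collect_eq_0[OF sets_infinite_cluster[OF r]] by simp
  from num_infinite_clusters_one_or_infinite[OF r this]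
  have "P.prob {\<eta> \<in> space P. ecard (infinite_clusters V (links s V \<eta>)) = 1} = 1 \<or>
      P.prob {\<eta> \<in> space P. ecard (infinite_clusters V (links s V \<eta>)) = \<infinity>} = 1"
    using P.prob_Collect_eq_1[OF sets_num_infinite_clusters] by blast
  moreover have "{\<eta> \<in> space P. ecard (infinite_clusters V (links s V \<eta>)) = c} =
      {\<eta> \<in> space P. ecard {C \<in> V // conn \<eta>. infinite C} = c}" for c
    using conn by (auto simp: infinite_clusters_def)
  ultimately show ?thesis by simp
qed

end

theorem theorem15:
  fixes V :: "'v set" and E :: "('v \<times> 'v) set" and d :: nat
    and r :: 'v and p :: "nat \<Rightarrow> real"
  assumes "transitive_digraph V E d"
    and "r \<in> V"
    and "degree_distribution d p"
  shows "(weak_theta V E d r p > 0 \<longrightarrow>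
            \<P>(\<omega> in config_measure V E d p. num_inf_weak V \<omega> = 1) = 1 \<or>
            \<P>(\<omega> in config_measure V E d p. num_inf_weak V \<omega> = \<infinity>) = 1)
       \<and> (strong_theta V E d r p > 0 \<longrightarrow>
            \<P>(\<omega> in config_measure V E d p. num_inf_strong V \<omega> = 1) = 1 \<or>
            \<P>(\<omega> in config_measure V E d p. num_inf_strong V \<omega> = \<infinity>) = 1)"
proof -
  interpret transitive_digraph V E d by fact
  interpret random_digraph V E d p by unfold_locales fact
  show ?thesis
    unfolding weak_theta_def strong_theta_def num_inf_weak_def num_inf_strong_def config_measure_eq
    using prob_num_infinite_clusters_one_or_infinite[OF assms(2) links_conn(1)]
      prob_num_infinite_clusters_one_or_infinite[OF assms(2) links_conn(2)] by blast
qed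

end
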